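(* Let $n\ge 1$, $\mathbf{x}\in[0,1]^n$, $G\in\mathbb{R}^{n\times n}$, $\delta=\epsilon\,\mathbf{1}^\top\mathbf{x}>0$, and let $C\in\mathbb{R}^{n\times n}$ be a cost matrix with nonnegative entries and $C_{ij}=0\Leftrightarrow i=j$. Consider the quadratic program $$\min_{\Pi\in\mathbb{R}^{n\times n},\,\Pi\ge 0}\ \tfrac12\|\Pi-G\|_{\mathrm F}^2\quad\text{subject to}\quad \Pi\mathbf{1}=\mathbf{x},\ \ \langle\Pi,C\rangle\le\delta. \qquad (P)$$ The dual of $(P)$ is $$\max_{\lambda\ge 0}\ g(\lambda),\qquad g(\lambda)=\min_{\Pi\mathbf{1}=\mathbf{x},\ \Pi\ge 0}\ \tfrac12\|\Pi-G\|_{\mathrm F}^2+\lambda\big(\langle\Pi,C\rangle-\delta\big).$$ In addition, the derivative of $g$ at a point $\lambda=\tilde\lambda$ is $$g'(\tilde\lambda)=\langle\tilde\Pi,C\rangle-\delta,\qquad\text{where}\quad \tilde\Pi=\operatorname*{argmin}_{\Pi\mathbf{1}=\mathbf{x},\ \Pi\ge0}\ \|\Pi-G+\tilde\lambda C\|_{\mathrm F}^2 .$$ Both $g(\lambda)$ and $g'(\lambda)$ can be evaluated in $O(n^2\log n)$ time deterministically for any given $\lambda$.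
   Context: $\mathbf{1}\in\mathbb{R}^n$ is the all-ones vector; $\Pi\ge0$ is entrywise; $\langle A,B\rangle=\sum_{i,j}A_{ij}B_{ij}$; $\|\cdot\|_{\mathrm F}$ is the Frobenius norm. "Dual" means the (partial) Lagrangian dual obtained by introducing a multiplier $\lambda\ge0$ for the constraint $\langle\Pi,C\rangle\le\delta$ while keeping the constraints $\Pi\ge0$, $\Pi\mathbf{1}=\mathbf{x}$ explicit. Running time counts exact real arithmetic operations and comparisons. $\epsilon>0$ is a scalar. *)

theory Defs
  imports
    Complex_Main
    "HOL-Library.Extended_Real"
    "HOL-Library.Landau_Symbols"
    "Jordan_Normal_Form.Matrix"
begin

section \<open>Lagrangian duality for one dualised inequality constraint\<close>

text \<open>
  A record \<open>Q\<close> stands for the program: minimise \<open>objective Q p\<close> over \<open>p \<in> domain_set Q\<close>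
  subject to \<open>constraint Q p \<le> 0\<close>.  The dual is partial: only the last inequality gets a
  multiplier, the constraint \<open>p \<in> domain_set Q\<close> is kept explicit.
\<close>

record 'a ineq_program =
  objective :: "'a \<Rightarrow> real"
  domain_set :: "'a set"
  constraint :: "'a \<Rightarrow> real"

definition feasible :: "'a ineq_program \<Rightarrow> 'a set" where
  "feasible Q = {p \<in> domain_set Q. constraint Q p \<le> 0}"

definition lagrangian :: "'a ineq_program \<Rightarrow> real \<Rightarrow> 'a \<Rightarrow> real" where
  "lagrangian Q l p = objective Q p + l * constraint Q p"

definition lagrange_dual_function :: "'a ineq_program \<Rightarrow> real \<Rightarrow> ereal" where
  "lagrange_dual_function Q l = (INF p\<in>domain_set Q. ereal (lagrangian Q l p))"

definition lagrange_dual_value :: "'a ineq_program \<Rightarrow> ereal" where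
  "lagrange_dual_value Q = (SUP l\<in>{0..}. lagrange_dual_function Q l)"


section \<open>The quadratic program\<close>

definition ones :: "nat \<Rightarrow> real vec" where
  "ones n = vec n (\<lambda>_. 1)"

definition frob_inner :: "real mat \<Rightarrow> real mat \<Rightarrow> real" where
  "frob_inner A B = (\<Sum>i<dim_row A. \<Sum>j<dim_col A. A $$ (i, j) * B $$ (i, j))"

definition frob_norm :: "real mat \<Rightarrow> real" where
  "frob_norm A = sqrt (frob_inner A A)"

text \<open>The order on matrices is the entrywise one.\<close>

definition couplings :: "nat \<Rightarrow> real vec \<Rightarrow> real mat set" where
  "couplings n x = {P \<in> carrier_mat n n. 0\<^sub>m n n \<le> P \<and> P *\<^sub>v ones n = x}"

definition qp_data ::
  "nat \<Rightarrow> real vec \<Rightarrow> real mat \<Rightarrow> real mat \<Rightarrow> real \<Rightarrow> real \<Rightarrow> bool" where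
  "qp_data n x G C \<epsilon> \<delta> \<longleftrightarrow>
     n \<ge> 1 \<and>
     x \<in> carrier_vec n \<and> (\<forall>i<n. 0 \<le> x $ i \<and> x $ i \<le> 1) \<and>
     G \<in> carrier_mat n n \<and>
     C \<in> carrier_mat n n \<and>
     (\<forall>i<n. \<forall>j<n. 0 \<le> C $$ (i, j) \<and> (C $$ (i, j) = 0 \<longleftrightarrow> i = j)) \<and>
     \<epsilon> > 0 \<and> \<delta> = \<epsilon> * (ones n \<bullet> x) \<and> \<delta> > 0"

definition qp ::
  "nat \<Rightarrow> real vec \<Rightarrow> real mat \<Rightarrow> real mat \<Rightarrow> real \<Rightarrow> real mat ineq_program" where
  "qp n x G C \<delta> =
     \<lparr> objective = (\<lambda>P. 1/2 * (frob_norm (P - G))\<^sup>2),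
       domain_set = couplings n x,
       constraint = (\<lambda>P. frob_inner P C - \<delta>) \<rparr>"

lemma feasible_qp:
  "feasible (qp n x G C \<delta>) =
     {P \<in> carrier_mat n n. 0\<^sub>m n n \<le> P \<and> P *\<^sub>v ones n = x \<and> frob_inner P C \<le> \<delta>}"
  by (auto simp: feasible_def qp_def couplings_def)

text \<open>
  \<open>LEAST\<close> denotes the minimum of the set of attained values; it is unspecified if there is
  no minimum, so attainment is something to be proved.
\<close>

definition dual_obj ::
  "nat \<Rightarrow> real vec \<Rightarrow> real mat \<Rightarrow> real mat \<Rightarrow> real \<Rightarrow> real \<Rightarrow> real" where
  "dual_obj n x G C \<delta> l =
     (LEAST v. \<exists>P\<in>couplings n x.
        v = 1/2 * (frob_norm (P - G))\<^sup>2 + l * (frob_inner P C - \<delta>))"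


section \<open>A real random access machine\<close>

text \<open>
  A deterministic while-language with natural-number index variables and two-dimensional arrays
  of exact reals.  A program is a finite syntactic object that does not depend on the input
  size.  Index arithmetic is restricted to addition and truncated subtraction, and the only real
  literals are integers, so that no information can be hidden in constants or in large indices.
  Real division is total with \<open>a / 0 = 0\<close>; a machine without this convention simulates it
  by one additional comparison.
\<close>

datatype iexp = INum nat | IVar string | IAdd iexp iexp | ISub iexp iexp

datatype rexp =
    RNum int
  | RArr string iexp iexp
  | RAdd rexp rexp
  | RSub rexp rexp
  | RMul rexp rexp
  | RDiv rexp rexp

datatype bexp = ILess iexp iexp | RLess rexp rexp | BNot bexp | BAnd bexp bexp

datatype com =
    Skip
  | IAssign string iexp
  | RAssign string iexp iexp rexp
  | Seq com com
  | Cond bexp com com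
  | While bexp com

type_synonym ivars = "string \<Rightarrow> nat"
type_synonym arrays = "string \<Rightarrow> nat \<Rightarrow> nat \<Rightarrow> real"
type_synonym state = "ivars \<times> arrays"

fun ival :: "iexp \<Rightarrow> ivars \<Rightarrow> nat" where
  "ival (INum k) s = k"
| "ival (IVar v) s = s v"
| "ival (IAdd a b) s = ival a s + ival b s"
| "ival (ISub a b) s = ival a s - ival b s"

fun rval :: "rexp \<Rightarrow> state \<Rightarrow> real" where
  "rval (RNum k) s = of_int k"
| "rval (RArr v a b) s = snd s v (ival a (fst s)) (ival b (fst s))"
| "rval (RAdd d e) s = rval d s + rval e s"
| "rval (RSub d e) s = rval d s - rval e s"
| "rval (RMul d e) s = rval d s * rval e s"
| "rval (RDiv d e) s = rval d s / rval e s"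

fun bval :: "bexp \<Rightarrow> state \<Rightarrow> bool" where
  "bval (ILess a b) s \<longleftrightarrow> ival a (fst s) < ival b (fst s)"
| "bval (RLess d e) s \<longleftrightarrow> rval d s < rval e s"
| "bval (BNot b) s \<longleftrightarrow> \<not> bval b s"
| "bval (BAnd b c) s \<longleftrightarrow> bval b s \<and> bval c s"

text \<open>
  Every node of an evaluated expression is charged one unit.  This charges each real arithmetic
  operation and each comparison, and in addition all memory accesses and all index arithmetic,
  so that the total cost bounds the number of real operations and comparisons from above.
\<close>

fun icost :: "iexp \<Rightarrow> nat" where
  "icost (INum k) = 1"
| "icost (IVar v) = 1"
| "icost (IAdd a b) = 1 + icost a + icost b"
| "icost (ISub a b) = 1 + icost a + icost b"

fun rcost :: "rexp \<Rightarrow> nat" where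
  "rcost (RNum k) = 1"
| "rcost (RArr v a b) = 1 + icost a + icost b"
| "rcost (RAdd d e) = 1 + rcost d + rcost e"
| "rcost (RSub d e) = 1 + rcost d + rcost e"
| "rcost (RMul d e) = 1 + rcost d + rcost e"
| "rcost (RDiv d e) = 1 + rcost d + rcost e"

fun bcost :: "bexp \<Rightarrow> nat" where
  "bcost (ILess a b) = 1 + icost a + icost b"
| "bcost (RLess d e) = 1 + rcost d + rcost e"
| "bcost (BNot b) = 1 + bcost b"
| "bcost (BAnd b c) = 1 + bcost b + bcost c"

definition arr_upd :: "arrays \<Rightarrow> string \<Rightarrow> nat \<Rightarrow> nat \<Rightarrow> real \<Rightarrow> arrays" where
  "arr_upd m v i j r = m(v := (m v)(i := (m v i)(j := r)))"

text \<open>\<open>exec c s t s'\<close>: started in state \<open>s\<close>, the program \<open>c\<close> halts in state \<open>s'\<close> after time \<open>t\<close>.\<close>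

inductive exec :: "com \<Rightarrow> state \<Rightarrow> nat \<Rightarrow> state \<Rightarrow> bool" where
  Skip: "exec Skip s 1 s"
| IAssign: "exec (IAssign v a) (s, m) (1 + icost a) (s(v := ival a s), m)"
| RAssign: "exec (RAssign v a b e) (s, m) (1 + icost a + icost b + rcost e)
     (s, arr_upd m v (ival a s) (ival b s) (rval e (s, m)))"
| Seq: "exec c1 s t1 s1 \<Longrightarrow> exec c2 s1 t2 s2 \<Longrightarrow> exec (Seq c1 c2) s (t1 + t2) s2"
| CondTrue: "bval b s \<Longrightarrow> exec c1 s t s1 \<Longrightarrow> exec (Cond b c1 c2) s (1 + bcost b + t) s1"
| CondFalse: "\<not> bval b s \<Longrightarrow> exec c2 s t s1 \<Longrightarrow> exec (Cond b c1 c2) s (1 + bcost b + t) s1"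
| WhileFalse: "\<not> bval b s \<Longrightarrow> exec (While b c) s (1 + bcost b) s"
| WhileTrue: "bval b s \<Longrightarrow> exec c s t1 s1 \<Longrightarrow> exec (While b c) s1 t2 s2 \<Longrightarrow>
     exec (While b c) s (1 + bcost b + t1 + t2) s2"

inductive_cases SkipE: "exec Skip s t s'"
inductive_cases IAssignE: "exec (IAssign v a) s t s'"
inductive_cases RAssignE: "exec (RAssign v a b e) s t s'"
inductive_cases SeqE: "exec (Seq c1 c2) s t s'"
inductive_cases CondE: "exec (Cond b c1 c2) s t s'"
inductive_cases WhileE: "exec (While b c) s t s'"

lemma exec_deterministic:
  "exec c s t s' \<Longrightarrow> exec c s u s'' \<Longrightarrow> u = t \<and> s'' = s'"
proof (induction arbitrary: u s'' rule: exec.induct)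
  case (Skip s)
  then show ?case by (auto elim: SkipE)
next
  case (IAssign v a s m)
  then show ?case by (auto elim: IAssignE)
next
  case (RAssign v a b e s m)
  then show ?case by (auto elim: RAssignE)
next
  case (Seq c1 s t1 s1 c2 t2 s2)
  from Seq.prems obtain u1 v1 u2 where
    u: "exec c1 s u1 v1" "exec c2 v1 u2 s''" "u = u1 + u2" by (rule SeqE)
  from Seq.IH(1)[OF u(1)] have 1: "u1 = t1" "v1 = s1" by auto
  from Seq.IH(2)[OF u(2)[unfolded 1]] show ?case using 1 u(3) by simp
next
  case (CondTrue b s c1 t s1 c2)
  from CondTrue.prems obtain w where "exec c1 s w s''" "u = 1 + bcost b + w"
    by (rule CondE) (use CondTrue.hyps(1) in simp_all)
  with CondTrue.IH show ?case by simp
next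
  case (CondFalse b s c2 t s1 c1)
  from CondFalse.prems obtain w where "exec c2 s w s''" "u = 1 + bcost b + w"
    by (rule CondE) (use CondFalse.hyps(1) in simp_all)
  with CondFalse.IH show ?case by simp
next
  case (WhileFalse b s c)
  from WhileFalse.prems show ?case
    by (rule WhileE) (use WhileFalse.hyps in simp_all)
next
  case (WhileTrue b s c t1 s1 t2 s2)
  from WhileTrue.prems obtain u1 v1 u2 where
    u: "exec c s u1 v1" "exec (While b c) v1 u2 s''" "u = 1 + bcost b + u1 + u2"
    by (rule WhileE) (use WhileTrue.hyps(1) in simp_all)
  from WhileTrue.IH(1)[OF u(1)] have 1: "u1 = t1" "v1 = s1" by auto
  from WhileTrue.IH(2)[OF u(2)[unfolded 1]] show ?case using 1 u(3) by simp
qed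

text \<open>
  The input: \<open>n\<close> is stored in an index variable, the real data in the arrays of the same name
  (a vector occupies row 0, a scalar cell (0, 0)); everything else is initially 0.
\<close>

definition input_ivars :: "nat \<Rightarrow> ivars" where
  "input_ivars n = (\<lambda>_. 0)(''n'' := n)"

definition input_arrays ::
  "nat \<Rightarrow> real vec \<Rightarrow> real mat \<Rightarrow> real mat \<Rightarrow> real \<Rightarrow> real \<Rightarrow> arrays" where
  "input_arrays n x G C \<delta> l = (\<lambda>_ _ _. 0)
     (''x'' := (\<lambda>i j. if i = 0 \<and> j < n then x $ j else 0),
      ''G'' := (\<lambda>i j. if i < n \<and> j < n then G $$ (i, j) else 0),
      ''C'' := (\<lambda>i j. if i < n \<and> j < n then C $$ (i, j) else 0),
      ''delta'' := (\<lambda>i j. if i = 0 \<and> j = 0 then \<delta> else 0),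
      ''lambda'' := (\<lambda>i j. if i = 0 \<and> j = 0 then l else 0))"

definition input_state ::
  "nat \<Rightarrow> real vec \<Rightarrow> real mat \<Rightarrow> real mat \<Rightarrow> real \<Rightarrow> real \<Rightarrow> state" where
  "input_state n x G C \<delta> l = (input_ivars n, input_arrays n x G C \<delta> l)"

definition result :: "state \<Rightarrow> string \<Rightarrow> real" where
  "result s v = snd s v 0 0"

end

theory Submission
  imports Defs
begin

text \<open>
  For fixed \<open>\<lambda>\<close> the inner problem splits into rows.  Writing \<open>y\<close> for a row of \<open>G - \<lambda> C\<close>, the
  minimiser in that row is \<open>max 0 (y - t)\<close>, where the threshold \<open>t\<close> makes the row sum right;
  since the objective is 1-strongly convex, every other coupling \<open>Q\<close> is worse than the
  minimiser \<open>P\<close> by at least half of the squared distance.  Completing the square in this estimate gives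
  \<open>\<bar>g(\<lambda> + h) - g(\<lambda>) - h (\<langle>P, C\<rangle> - \<delta>)\<bar> \<le> h\<^sup>2 \<parallel>C\<parallel>\<^sup>2 / 2\<close>, hence the derivative without any
  compactness argument.  The maximum of \<open>g\<close> over \<open>\<lambda> \<ge> 0\<close> is attained because the diagonal coupling
  has cost zero, so that \<open>g(\<lambda>) \<le> c - \<lambda> \<delta>\<close>.

  The program sorts each row in decreasing order by bottom-up merge sort and then adds the entries
  one by one, updating \<open>t\<close> to the average excess of the entries seen so far whenever the new
  entry lies above the old threshold.
\<close>

section \<open>The dual function\<close>

lemma frob_norm_square: "(frob_norm A)\<^sup>2 = frob_inner A A"
proof -
  have "0 \<le> frob_inner A A" unfolding frob_inner_def by (intro sum_nonneg) simp
  then show ?thesis by (simp add: frob_norm_def)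
qed

lemma frob_inner_carrier:
  assumes "A \<in> carrier_mat m n"
  shows "frob_inner A B = (\<Sum>i<m. \<Sum>j<n. A $$ (i, j) * B $$ (i, j))"
  using assms by (simp add: frob_inner_def)

lemma couplings_iff:
  assumes "x \<in> carrier_vec n"
  shows "P \<in> couplings n x \<longleftrightarrow> P \<in> carrier_mat n n \<and>
    (\<forall>i<n. \<forall>j<n. 0 \<le> P $$ (i, j)) \<and> (\<forall>i<n. (\<Sum>j<n. P $$ (i, j)) = x $ i)"
proof -
  have "(P *\<^sub>v ones n = x) = (\<forall>i<n. (\<Sum>j<n. P $$ (i, j)) = x $ i)" if "P \<in> carrier_mat n n"
    using that assms
    by (auto simp: vec_eq_iff scalar_prod_def ones_def atLeast0LessThan)
  moreover have "0\<^sub>m n n \<le> P \<longleftrightarrow> (\<forall>i<n. \<forall>j<n. 0 \<le> P $$ (i, j))" if "P \<in> carrier_mat n n"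
    using that by (auto simp: less_eq_mat_def)
  ultimately show ?thesis
    unfolding couplings_def by blast
qed

text \<open>Intermediate value theorem in \<open>t\<close>: the sum vanishes at the largest entry
  \<open>?M\<close>, and at \<open>?M - b\<close> the largest entry alone already contributes
  \<open>b\<close>.\<close>

lemma simplex_threshold_exists:
  fixes y :: "nat \<Rightarrow> real"
  assumes "1 \<le> n" and "0 \<le> b"
  shows "\<exists>t. (\<Sum>j<n. max 0 (y j - t)) = b"
proof -
  let ?f = "\<lambda>t. \<Sum>j<n. max 0 (y j - t)"
  let ?M = "Max (y ` {..<n})"
  have ne: "finite (y ` {..<n})" "y ` {..<n} \<noteq> {}"
    using assms(1) by (auto simp: lessThan_empty_iff)
  have "y j \<le> ?M" if "j < n" for j
    using that by (intro Max_ge) auto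
  then have "?f ?M = 0" by (intro sum.neutral) auto
  moreover have "b \<le> ?f (?M - b)"
  proof -
    obtain k where k: "k < n" "y k = ?M" using Max_in[OF ne] by auto
    have "max 0 (y k - (?M - b)) \<le> ?f (?M - b)"
      using k by (intro member_le_sum) auto
    then show ?thesis using k by simp
  qed
  ultimately have "\<exists>t\<ge>?M - b. t \<le> ?M \<and> ?f t = b"
    using assms(2) by (intro IVT2') (auto intro!: continuous_intros)
  then show ?thesis by blast
qed

text \<open>Once \<open>\<theta> i\<close> is fitted to the row sum, row \<open>i\<close> is the
  Euclidean projection of the corresponding row of \<open>G - l C\<close> onto a scaled simplex. The
  thresholds are a parameter because the program produces its own.\<close>

definition shrink :: "nat \<Rightarrow> real mat \<Rightarrow> real mat \<Rightarrow> real \<Rightarrow> (nat \<Rightarrow> real) \<Rightarrow> real mat" where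
  "shrink n G C l \<theta> = mat n n (\<lambda>(i, j). max 0 (G $$ (i, j) - l * C $$ (i, j) - \<theta> i))"

locale quadratic_program =
  fixes n x G C \<epsilon> \<delta>
  assumes data: "qp_data n x G C \<epsilon> \<delta>"
begin

lemma carriers: "x \<in> carrier_vec n" "G \<in> carrier_mat n n" "C \<in> carrier_mat n n"
  and n_pos: "1 \<le> n" and delta_pos: "0 < \<delta>"
  and x_nonneg: "i < n \<Longrightarrow> 0 \<le> x $ i"
  and C_diag: "i < n \<Longrightarrow> C $$ (i, i) = 0"
  using data by (auto simp: qp_data_def)

abbreviation lagr :: "real \<Rightarrow> real mat \<Rightarrow> real" where
  "lagr l P \<equiv> 1/2 * (frob_norm (P - G))\<^sup>2 + l * (frob_inner P C - \<delta>)"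

section \<open>The Lagrangian as an entrywise quadratic\<close>

lemma frob_norm_square_minus:
  assumes "P \<in> carrier_mat n n" "Q \<in> carrier_mat n n"
  shows "(frob_norm (Q - P))\<^sup>2 = (\<Sum>i<n. \<Sum>j<n. (Q $$ (i, j) - P $$ (i, j))\<^sup>2)"
  using assms carriers
  by (subst frob_norm_square, subst frob_inner_carrier[of _ n n])
     (auto intro!: sum.cong simp: power2_eq_square)

lemma lagr_sum:
  assumes "P \<in> carrier_mat n n"
  shows "lagr l P =
    (\<Sum>i<n. \<Sum>j<n. 1/2 * (P $$ (i, j) - G $$ (i, j))\<^sup>2 + l * (P $$ (i, j) * C $$ (i, j))) - l * \<delta>"
  using assms carriers
  by (simp add: frob_norm_square_minus frob_inner_carrier[of _ n n] sum.distrib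
      sum_distrib_left right_diff_distrib)

text \<open>Completing the square: up to the factor 2 and a term free of \<open>P\<close>, the
  squared norm is the Lagrangian, so both have the same minimisers.\<close>

lemma norm_square_conv_lagr:
  assumes "P \<in> carrier_mat n n"
  shows "(frob_norm (P - G + l \<cdot>\<^sub>m C))\<^sup>2 =
    2 * lagr l P + (2 * l * \<delta> + (\<Sum>i<n. \<Sum>j<n. l\<^sup>2 * (C $$ (i, j))\<^sup>2 - 2 * l * G $$ (i, j) * C $$ (i, j)))"
proof -
  have "(frob_norm (P - G + l \<cdot>\<^sub>m C))\<^sup>2 =
      (\<Sum>i<n. \<Sum>j<n. (P $$ (i, j) - G $$ (i, j) + l * C $$ (i, j))\<^sup>2)"
    using assms carriers
    by (subst frob_norm_square, subst frob_inner_carrier[of _ n n])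
       (auto intro!: sum.cong simp: power2_eq_square)
  also have "\<dots> = 2 * (\<Sum>i<n. \<Sum>j<n. 1/2 * (P $$ (i, j) - G $$ (i, j))\<^sup>2 + l * (P $$ (i, j) * C $$ (i, j)))
      + (\<Sum>i<n. \<Sum>j<n. l\<^sup>2 * (C $$ (i, j))\<^sup>2 - 2 * l * G $$ (i, j) * C $$ (i, j))"
    unfolding sum_distrib_left sum.distrib[symmetric]
    by (intro sum.cong refl) (simp add: power2_eq_square algebra_simps)
  finally show ?thesis
    unfolding lagr_sum[OF assms] by simp
qed

text \<open>Quadratic growth is recorded instead of bare minimality: the squared distance yields
  uniqueness and absorbs the movement of the minimiser in the derivative estimate.\<close>

definition strong_min :: "real \<Rightarrow> real mat \<Rightarrow> bool" where
  "strong_min l P \<longleftrightarrow> P \<in> couplings n x \<and>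
     (\<forall>Q\<in>couplings n x. lagr l P + 1/2 * (frob_norm (Q - P))\<^sup>2 \<le> lagr l Q)"

lemma couplings_carrier: "P \<in> couplings n x \<Longrightarrow> P \<in> carrier_mat n n"
  by (simp add: couplings_def)

text \<open>First-order optimality with \<open>\<theta> i\<close> as multiplier of the
  \<open>i\<close>-th row sum. The gradient at \<open>?P\<close> equals \<open>- \<theta> i\<close>
  on entries that are not truncated and exceeds it on truncated ones, where \<open>Q - ?P\<close> is
  nonnegative.\<close>

lemma strong_min_shrink:
  assumes \<theta>: "\<And>i. i < n \<Longrightarrow> (\<Sum>j<n. max 0 (G $$ (i, j) - l * C $$ (i, j) - \<theta> i)) = x $ i"
  shows "strong_min l (shrink n G C l \<theta>)"
proof -
  let ?P = "shrink n G C l \<theta>"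
  have P: "?P \<in> couplings n x"
    using \<theta> carriers by (auto simp: couplings_iff shrink_def)
  moreover have "lagr l ?P + 1/2 * (frob_norm (Q - ?P))\<^sup>2 \<le> lagr l Q" if Q: "Q \<in> couplings n x" for Q
  proof -
    have Qc: "Q \<in> carrier_mat n n" and Pc: "?P \<in> carrier_mat n n"
      using P Q by (auto dest: couplings_carrier)
    let ?d = "\<lambda>i j. Q $$ (i, j) - ?P $$ (i, j)"
    \<comment> \<open>Both matrices have the same row sums, so a multiplier that is constant along
      each row contributes nothing.\<close>
    have "0 = (\<Sum>i<n. - \<theta> i * (\<Sum>j<n. ?d i j))"
      using P Q carriers by (auto simp: couplings_iff sum_subtractf)
    also have "\<dots> = (\<Sum>i<n. \<Sum>j<n. - \<theta> i * ?d i j)"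
      by (simp only: sum_distrib_left)
    also have "\<dots> \<le> (\<Sum>i<n. \<Sum>j<n. (?P $$ (i, j) - G $$ (i, j) + l * C $$ (i, j)) * ?d i j)"
    proof (intro sum_mono)
      fix i j assume "i \<in> {..<n}" "j \<in> {..<n}"
      then have ij: "i < n" "j < n" by auto
      have q: "0 \<le> Q $$ (i, j)" using Q ij carriers by (auto simp: couplings_iff)
      show "- \<theta> i * ?d i j \<le> (?P $$ (i, j) - G $$ (i, j) + l * C $$ (i, j)) * ?d i j"
      proof (cases "0 \<le> G $$ (i, j) - l * C $$ (i, j) - \<theta> i")
        case True
        then show ?thesis using ij by (simp add: shrink_def)
      next
        case False
        \<comment> \<open>A truncated entry: \<open>?P\<close> is zero here, so
          \<open>?d i j\<close> is the nonnegative entry of \<open>Q\<close>.\<close>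
        then have "- \<theta> i * Q $$ (i, j) \<le> (- G $$ (i, j) + l * C $$ (i, j)) * Q $$ (i, j)"
          using q by (intro mult_right_mono) auto
        then show ?thesis using False ij by (simp add: shrink_def)
      qed
    qed
    \<comment> \<open>The Lagrangian is quadratic with identity Hessian, so its second-order Taylor
      expansion at \<open>?P\<close> is exact.\<close>
    also have "\<dots> = lagr l Q - lagr l ?P - 1/2 * (frob_norm (Q - ?P))\<^sup>2"
      unfolding lagr_sum[OF Qc] lagr_sum[OF Pc] frob_norm_square_minus[OF Pc Qc]
      by (simp add: sum_distrib_left sum_subtractf[symmetric])
         (intro sum.cong refl, simp add: power2_eq_square field_simps)
    finally show ?thesis by simp
  qed
  ultimately show ?thesis by (simp add: strong_min_def)
qed

section \<open>Existence and uniqueness of the minimiser\<close>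

lemma strong_min_exists: "\<exists>P. strong_min l P"
proof -
  define \<theta> where "\<theta> i = (SOME t. (\<Sum>j<n. max 0 (G $$ (i, j) - l * C $$ (i, j) - t)) = x $ i)" for i
  have "(\<Sum>j<n. max 0 (G $$ (i, j) - l * C $$ (i, j) - \<theta> i)) = x $ i" if "i < n" for i
    unfolding \<theta>_def by (rule someI_ex, rule simplex_threshold_exists[OF n_pos x_nonneg[OF that]])
  then show ?thesis using strong_min_shrink by blast
qed

lemma strong_min_le:
  assumes "strong_min l P" "Q \<in> couplings n x"
  shows "lagr l P \<le> lagr l Q"
proof -
  have "lagr l P + 1/2 * (frob_norm (Q - P))\<^sup>2 \<le> lagr l Q"
    using assms by (simp add: strong_min_def)
  moreover have "0 \<le> (frob_norm (Q - P))\<^sup>2" by simp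
  ultimately show ?thesis by linarith
qed

lemma dual_obj_strong_min:
  assumes "strong_min l P"
  shows "dual_obj n x G C \<delta> l = lagr l P"
  unfolding dual_obj_def
  using assms strong_min_le[OF assms] by (intro Least_equality) (auto simp: strong_min_def)

lemma strong_min_is_arg_min:
  assumes "strong_min l P"
  shows "is_arg_min (lagr l) (\<lambda>P. P \<in> couplings n x) P"
  using assms strong_min_le[OF assms]
  by (auto simp: is_arg_min_linorder strong_min_def)

lemma is_arg_min_norm_iff:
  "is_arg_min (\<lambda>P. (frob_norm (P - G + l \<cdot>\<^sub>m C))\<^sup>2) (\<lambda>P. P \<in> couplings n x) P \<longleftrightarrow>
   is_arg_min (lagr l) (\<lambda>P. P \<in> couplings n x) P"
proof -
  have "(frob_norm (Q - G + l \<cdot>\<^sub>m C))\<^sup>2 \<le> (frob_norm (R - G + l \<cdot>\<^sub>m C))\<^sup>2 \<longleftrightarrow> lagr l Q \<le> lagr l R"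
    if "Q \<in> couplings n x" "R \<in> couplings n x" for Q R
    unfolding norm_square_conv_lagr[OF couplings_carrier[OF that(1)]]
      norm_square_conv_lagr[OF couplings_carrier[OF that(2)]]
    by (simp only: add_le_cancel_right mult_le_cancel_left_pos zero_less_numeral)
  then show ?thesis
    unfolding is_arg_min_linorder by blast
qed

text \<open>A competitor that is no worse leaves no room for the growth term, so its distance from
  \<open>P\<close> is zero.\<close>

lemma strong_min_eqI:
  assumes P: "strong_min l P" and Q: "Q \<in> couplings n x" and "lagr l Q \<le> lagr l P"
  shows "Q = P"
proof -
  have Pc: "P \<in> carrier_mat n n" and Qc: "Q \<in> carrier_mat n n"
    using P Q by (auto simp: strong_min_def couplings_carrier)
  have "lagr l P + 1/2 * (frob_norm (Q - P))\<^sup>2 \<le> lagr l Q"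
    using P Q by (simp add: strong_min_def)
  then have "(frob_norm (Q - P))\<^sup>2 \<le> 0" using assms(3) by linarith
  then have "(\<Sum>i<n. \<Sum>j<n. (Q $$ (i, j) - P $$ (i, j))\<^sup>2) = 0"
    using Pc Qc by (simp add: frob_norm_square_minus order_antisym sum_nonneg)
  then show "Q = P"
    using Pc Qc by (auto simp: sum_nonneg_eq_0_iff sum_nonneg)
qed

text \<open>Minimality yields quadratic growth because some strong minimiser exists and every
  minimiser coincides with it.\<close>

lemma is_arg_min_iff_strong_min:
  "is_arg_min (lagr l) (\<lambda>P. P \<in> couplings n x) Q \<longleftrightarrow> strong_min l Q"
  (is "?L \<longleftrightarrow> ?R")
proof
  assume L: ?L
  obtain P where P: "strong_min l P" using strong_min_exists by blast
  have Q: "Q \<in> couplings n x" and "lagr l Q \<le> lagr l P"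
    using L P by (auto simp: is_arg_min_linorder strong_min_def)
  then show ?R using strong_min_eqI[OF P Q] P by simp
qed (rule strong_min_is_arg_min)

section \<open>Derivative of the dual function\<close>

lemma dual_obj_expansion:
  assumes "strong_min l P"
  defines "D \<equiv> frob_inner P C - \<delta>" and "K \<equiv> frob_inner C C / 2"
  shows "\<bar>dual_obj n x G C \<delta> (l + h) - dual_obj n x G C \<delta> l - h * D\<bar> \<le> K * h\<^sup>2"
proof -
  obtain Q where Q: "strong_min (l + h) Q" using strong_min_exists by blast
  have Pc: "P \<in> carrier_mat n n" and Qc: "Q \<in> carrier_mat n n"
    using assms(1) Q by (auto simp: strong_min_def couplings_carrier)
  note g = dual_obj_strong_min[OF assms(1)] dual_obj_strong_min[OF Q]
  have shift: "lagr (l + h) R = lagr l R + h * (frob_inner R C - \<delta>)" for R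
    by (simp add: algebra_simps)
  \<comment> \<open>Upper bound: the old minimiser \<open>P\<close> is still a coupling and hence a
    competitor at \<open>l + h\<close>.\<close>
  have "lagr (l + h) Q \<le> lagr (l + h) P"
    using assms(1) by (intro strong_min_le[OF Q]) (simp add: strong_min_def)
  then have upper: "dual_obj n x G C \<delta> (l + h) \<le> dual_obj n x G C \<delta> l + h * D"
    unfolding g shift[of P] D_def .
  \<comment> \<open>Lower bound: moving from \<open>P\<close> to \<open>Q\<close> changes the cost
    term by \<open>h * (frob_inner Q C - frob_inner P C)\<close>. The growth term of
    \<open>P\<close> pays for this up to \<open>K * h\<^sup>2\<close>, as the square of
    \<open>Q - P + h C\<close> shows, so the distance from \<open>P\<close> to \<open>Q\<close> need
    not be estimated.\<close>
  have "0 \<le> (\<Sum>i<n. \<Sum>j<n. 1/2 * (Q $$ (i, j) - P $$ (i, j) + h * C $$ (i, j))\<^sup>2)"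
    by (intro sum_nonneg) simp
  also have "\<dots> = 1/2 * (frob_norm (Q - P))\<^sup>2 + h * (frob_inner Q C - frob_inner P C) + K * h\<^sup>2"
    unfolding frob_norm_square_minus[OF Pc Qc] frob_inner_carrier[OF Qc] frob_inner_carrier[OF Pc]
      frob_inner_carrier[OF carriers(3)] K_def times_divide_eq_left mult.commute[of _ "h\<^sup>2"]
      sum_distrib_left sum.distrib[symmetric] sum_subtractf[symmetric] sum_divide_distrib
    by (intro sum.cong refl) (simp add: power2_eq_square field_simps)
  finally have "0 \<le> 1/2 * (frob_norm (Q - P))\<^sup>2 + h * (frob_inner Q C - frob_inner P C) + K * h\<^sup>2" .
  moreover have "lagr l P + 1/2 * (frob_norm (Q - P))\<^sup>2 \<le> lagr l Q"
    using assms(1) Q by (simp add: strong_min_def)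
  ultimately have lower: "dual_obj n x G C \<delta> l + h * D - K * h\<^sup>2 \<le> dual_obj n x G C \<delta> (l + h)"
    unfolding g shift[of Q] D_def by (simp add: algebra_simps)
  have "0 \<le> K * h\<^sup>2" unfolding K_def frob_norm_square[symmetric] by simp
  then show ?thesis using upper lower by linarith
qed

text \<open>Dividing the expansion by \<open>h\<close> leaves an error of at most
  \<open>?K * \<bar>h\<bar>\<close>. Since \<open>l\<close> and \<open>h\<close> may have either
  sign, the derivative is two-sided even at \<open>l = 0\<close>.\<close>

lemma dual_obj_deriv:
  assumes "strong_min l P"
  shows "(dual_obj n x G C \<delta> has_real_derivative (frob_inner P C - \<delta>)) (at l)"
proof -
  let ?g = "dual_obj n x G C \<delta>" and ?D = "frob_inner P C - \<delta>" and ?K = "frob_inner C C / 2"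
  have "\<bar>(?g (l + h) - ?g l) / h - ?D\<bar> \<le> ?K * \<bar>h\<bar>" if "h \<noteq> 0" for h
  proof -
    have "(?g (l + h) - ?g l) / h - ?D = (?g (l + h) - ?g l - h * ?D) / h"
      using that by (subst diff_divide_distrib) simp
    then have "\<bar>(?g (l + h) - ?g l) / h - ?D\<bar> * \<bar>h\<bar> = \<bar>?g (l + h) - ?g l - h * ?D\<bar>"
      using that by (simp only: abs_divide) simp
    also have "\<dots> \<le> ?K * \<bar>h\<bar> * \<bar>h\<bar>"
      using dual_obj_expansion[OF assms, of h] by (simp add: power2_eq_square mult.assoc)
    finally show ?thesis using that by simp
  qed
  then have "\<forall>\<^sub>F h in at 0. norm ((?g (l + h) - ?g l) / h - ?D) \<le> norm h * ?K"
    unfolding real_norm_def mult.commute[of _ ?K] eventually_at_filter by (intro always_eventually) blast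
  then have "((\<lambda>h. (?g (l + h) - ?g l) / h - ?D) \<longlongrightarrow> 0) (at 0)"
    by (rule tendsto_0_le[OF tendsto_ident_at])
  then show ?thesis
    by (simp only: DERIV_def LIM_zero_iff)
qed

section \<open>The Lagrangian dual and attainment of its maximum\<close>

lemma lagrange_dual_function_qp:
  "lagrange_dual_function (qp n x G C \<delta>) l = ereal (dual_obj n x G C \<delta> l)"
proof -
  obtain P where P: "strong_min l P" using strong_min_exists by blast
  show ?thesis
    unfolding lagrange_dual_function_def dual_obj_strong_min[OF P]
    using P strong_min_le[OF P]
    by (intro INF_eqI) (auto simp: lagrangian_def qp_def strong_min_def)
qed

text \<open>The diagonal coupling meets \<open>C\<close> only in its zero diagonal, so its
  Lagrangian is a line of slope \<open>- \<delta>\<close> in \<open>l\<close> that dominates the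
  dual function. A maximum over a compact interval is therefore a maximum over the
  half-line.\<close>

lemma dual_obj_attains_max:
  "\<exists>l0\<ge>0. \<forall>l\<ge>0. dual_obj n x G C \<delta> l \<le> dual_obj n x G C \<delta> l0"
proof -
  let ?g = "dual_obj n x G C \<delta>"
  let ?P = "mat n n (\<lambda>(i, j). if i = j then x $ i else 0)"
  have P: "?P \<in> couplings n x"
    using carriers x_nonneg by (auto simp: couplings_iff)
  have "frob_inner ?P C = 0"
    using C_diag by (auto simp: frob_inner_def intro!: sum.neutral)
  then have le: "?g l \<le> 1/2 * (frob_norm (?P - G))\<^sup>2 - l * \<delta>" for l
    using strong_min_exists[of l] strong_min_le[OF _ P] dual_obj_strong_min by fastforce
  \<comment> \<open>The point where the dominating line has fallen to \<open>?g 0\<close>; the outer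
    maximum keeps the interval \<open>{0..L}\<close> nonempty.\<close>
  define L where "L = max 0 ((1/2 * (frob_norm (?P - G))\<^sup>2 - ?g 0) / \<delta>)"
  have beyond: "?g l \<le> ?g 0" if "L \<le> l" for l
  proof -
    have "(1/2 * (frob_norm (?P - G))\<^sup>2 - ?g 0) / \<delta> \<le> l" using that by (simp add: L_def)
    then have "1/2 * (frob_norm (?P - G))\<^sup>2 - ?g 0 \<le> l * \<delta>"
      using delta_pos by (simp add: pos_divide_le_eq)
    then show ?thesis using le[of l] by linarith
  qed
  have "continuous_on {0..L} ?g"
    using strong_min_exists dual_obj_deriv
    by (meson DERIV_isCont continuous_at_imp_continuous_on)
  moreover have "0 \<le> L" by (simp add: L_def)
  ultimately obtain l0 where l0: "l0 \<in> {0..L}" "\<forall>l\<in>{0..L}. ?g l \<le> ?g l0"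
    using continuous_attains_sup[of "{0..L}" ?g] by auto
  moreover have "?g 0 \<le> ?g l0" using l0 \<open>0 \<le> L\<close> by simp
  ultimately show ?thesis
    using beyond by (metis atLeastAtMost_iff linorder_le_cases order_trans)
qed

lemma lagrange_dual_value_qp:
  assumes "0 \<le> l0" "\<forall>l\<ge>0. dual_obj n x G C \<delta> l \<le> dual_obj n x G C \<delta> l0"
  shows "lagrange_dual_value (qp n x G C \<delta>) = ereal (dual_obj n x G C \<delta> l0)"
  unfolding lagrange_dual_value_def lagrange_dual_function_qp
proof (rule SUP_eqI)
  fix y :: ereal
  assume "\<And>l. l \<in> {0..} \<Longrightarrow> ereal (dual_obj n x G C \<delta> l) \<le> y"
  then show "ereal (dual_obj n x G C \<delta> l0) \<le> y" using assms(1) by simp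
qed (use assms(2) in simp)

end

section \<open>Running time of programs\<close>

text \<open>Total correctness from one start state. The time is only an upper bound, so bounds of
  parts can be added and weakened without knowing which branches are taken.\<close>

definition runs :: "com \<Rightarrow> state \<Rightarrow> nat \<Rightarrow> (state \<Rightarrow> bool) \<Rightarrow> bool" where
  "runs c s t Q \<longleftrightarrow> (\<exists>u s'. exec c s u s' \<and> u \<le> t \<and> Q s')"

lemma runs_mono:
  assumes "runs c s t Q" "t \<le> t'" "\<And>s'. Q s' \<Longrightarrow> Q' s'"
  shows "runs c s t' Q'"
  using assms unfolding runs_def by (meson order_trans)

lemma runs_Seq:
  assumes "runs c1 s t1 R" "\<And>s'. R s' \<Longrightarrow> runs c2 s' t2 Q"
  shows "runs (Seq c1 c2) s (t1 + t2) Q"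
  using assms unfolding runs_def by (meson exec.Seq add_mono)

text \<open>The index \<open>k\<close> of the invariant is a variant: it drops in every round and so
  bounds the number of rounds still to come. \<open>Suc\<close> pays for the last, failing
  test.\<close>

lemma runs_While:
  assumes body: "\<And>k s. I k s \<Longrightarrow> bval b s \<Longrightarrow> runs c s t (\<lambda>s'. \<exists>k'<k. I k' s')"
    and "I k s"
  shows "runs (While b c) s (Suc k * (1 + bcost b + t)) (\<lambda>s'. (\<exists>k'. I k' s') \<and> \<not> bval b s')"
  using \<open>I k s\<close>
proof (induction k arbitrary: s rule: less_induct)
  case (less k)
  show ?case
  proof (cases "bval b s")
    case False
    then show ?thesis
      using less.prems exec.WhileFalse[OF False, of c] unfolding runs_def
      by (intro exI[of _ "1 + bcost b"] exI[of _ s]) auto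
  next
    case True
    then obtain u s1 k' where 1: "exec c s u s1" "u \<le> t" "k' < k" "I k' s1"
      using body[OF less.prems] unfolding runs_def by blast
    then obtain u' s' where 2: "exec (While b c) s1 u' s'" "u' \<le> Suc k' * (1 + bcost b + t)"
        "\<exists>k'. I k' s'" "\<not> bval b s'"
      using less.IH unfolding runs_def by blast
    \<comment> \<open>Since \<open>k' < k\<close>, the remaining run fits into \<open>k\<close>
      rounds and leaves one for the round just made.\<close>
    have "u' \<le> k * (1 + bcost b + t)"
      using 1(3) by (intro order_trans[OF 2(2)] mult_right_mono) auto
    then have "1 + bcost b + u + u' \<le> Suc k * (1 + bcost b + t)"
      using 1(2) by simp
    then show ?thesis
      using exec.WhileTrue[OF True 1(1) 2(1)] 2(3,4) unfolding runs_def by blast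
  qed
qed

section \<open>Loop-free programs as functions on states\<close>

fun loop_free :: "com \<Rightarrow> bool" where
  "loop_free (Seq c1 c2) \<longleftrightarrow> loop_free c1 \<and> loop_free c2"
| "loop_free (Cond b c1 c2) \<longleftrightarrow> loop_free c1 \<and> loop_free c2"
| "loop_free (While b c) \<longleftrightarrow> False"
| "loop_free _ \<longleftrightarrow> True"

text \<open>On loops \<open>eff\<close> and \<open>max_cost\<close> below are junk; both are used only under \<open>loop_free\<close>.\<close>

fun eff :: "com \<Rightarrow> state \<Rightarrow> state" where
  "eff (IAssign v a) s = ((fst s)(v := ival a (fst s)), snd s)"
| "eff (RAssign v a b e) s =
     (fst s, arr_upd (snd s) v (ival a (fst s)) (ival b (fst s)) (rval e s))"
| "eff (Seq c1 c2) s = eff c2 (eff c1 s)"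
| "eff (Cond b c1 c2) s = (if bval b s then eff c1 s else eff c2 s)"
| "eff _ s = s"

fun max_cost :: "com \<Rightarrow> nat" where
  "max_cost (IAssign v a) = 1 + icost a"
| "max_cost (RAssign v a b e) = 1 + icost a + icost b + rcost e"
| "max_cost (Seq c1 c2) = max_cost c1 + max_cost c2"
| "max_cost (Cond b c1 c2) = 1 + bcost b + max (max_cost c1) (max_cost c2)"
| "max_cost _ = 1"

text \<open>Reduces the verification of a loop body to evaluating \<open>eff\<close>, at a cost that
  depends on the program text alone.\<close>

lemma exec_loop_free: "loop_free c \<Longrightarrow> \<exists>u\<le>max_cost c. exec c s u (eff c s)"
proof (induction c arbitrary: s)
  case Skip
  show ?case using exec.Skip[of s] by auto
next
  case (IAssign v a)
  show ?case using exec.IAssign[of v a "fst s" "snd s"] by auto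
next
  case (RAssign v a b e)
  show ?case using exec.RAssign[of v a b e "fst s" "snd s"] by auto
next
  case (Seq c1 c2)
  then obtain u1 u2 where "u1 \<le> max_cost c1" "exec c1 s u1 (eff c1 s)"
      "u2 \<le> max_cost c2" "exec c2 (eff c1 s) u2 (eff c2 (eff c1 s))"
    by (meson loop_free.simps(1))
  then show ?case by (auto intro!: exI[of _ "u1 + u2"] exec.Seq)
next
  case (Cond b c1 c2)
  then obtain u1 u2 where "u1 \<le> max_cost c1" "exec c1 s u1 (eff c1 s)"
      "u2 \<le> max_cost c2" "exec c2 s u2 (eff c2 s)"
    by (meson loop_free.simps(2))
  then show ?case
    using exec.CondTrue[of b s c1 u1 "eff c1 s" c2] exec.CondFalse[of b s c2 u2 "eff c2 s" c1]
    by (intro exI[of _ "1 + bcost b + (if bval b s then u1 else u2)"]) auto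
next
  case (While b c)
  then show ?case by simp
qed

lemma runs_loop_free:
  assumes "loop_free c" "Q (eff c s)"
  shows "runs c s (max_cost c) Q"
  using exec_loop_free[OF assms(1), of s] assms(2) unfolding runs_def by blast

section \<open>Frame conditions\<close>

fun index_writes :: "com \<Rightarrow> string set" where
  "index_writes (IAssign v a) = {v}"
| "index_writes (Seq c1 c2) = index_writes c1 \<union> index_writes c2"
| "index_writes (Cond b c1 c2) = index_writes c1 \<union> index_writes c2"
| "index_writes (While b c) = index_writes c"
| "index_writes _ = {}"

fun array_writes :: "com \<Rightarrow> string set" where
  "array_writes (RAssign v a b e) = {v}"
| "array_writes (Seq c1 c2) = array_writes c1 \<union> array_writes c2"
| "array_writes (Cond b c1 c2) = array_writes c1 \<union> array_writes c2"
| "array_writes (While b c) = array_writes c"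
| "array_writes _ = {}"

lemma exec_frame:
  assumes "exec c s t s'"
  shows "(\<forall>v. v \<notin> index_writes c \<longrightarrow> fst s' v = fst s v) \<and>
         (\<forall>v. v \<notin> array_writes c \<longrightarrow> snd s' v = snd s v)"
  using assms by induction (auto simp: arr_upd_def)

text \<open>Lets each specification mention only what its program computes; that inputs and outer
  counters survive is read off the syntax.\<close>

lemma runs_frame:
  assumes "runs c s t Q"
  shows "runs c s t (\<lambda>s'. Q s' \<and> (\<forall>v. v \<notin> index_writes c \<longrightarrow> fst s' v = fst s v) \<and>
                         (\<forall>v. v \<notin> array_writes c \<longrightarrow> snd s' v = snd s v))"
  using assms exec_frame unfolding runs_def by blast

section \<open>Counting loops\<close>

definition For :: "string \<Rightarrow> nat \<Rightarrow> com \<Rightarrow> com" where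
  "For v a c = Seq (IAssign v (INum a))
     (While (ILess (IVar v) (IVar ''n'')) (Seq c (IAssign v (IAdd (IVar v) (INum 1)))))"

lemma writes_For [simp]:
  "index_writes (For v a c) = insert v (index_writes c)"
  "array_writes (For v a c) = array_writes c"
  by (auto simp: For_def)

text \<open>The postcondition in \<open>step\<close> advances the counter itself, so bodies are
  verified without the increment. A round costs 4 for the test and 4 for the increment besides the
  body; the bound allows \<open>Suc N\<close> rounds also when \<open>a\<close> is positive.\<close>

lemma runs_For:
  assumes n: "fst s ''n'' = N" and a: "a \<le> N"
    and v: "v \<noteq> ''n''" "v \<notin> index_writes c" "''n'' \<notin> index_writes c"
    and init: "I a ((fst s)(v := a), snd s)"
    and step: "\<And>k s. a \<le> k \<Longrightarrow> k < N \<Longrightarrow> fst s v = k \<Longrightarrow> fst s ''n'' = N \<Longrightarrow> I k s \<Longrightarrow>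
      runs c s t (\<lambda>s'. I (Suc k) ((fst s')(v := Suc k), snd s'))"
  shows "runs (For v a c) s (2 + Suc N * (8 + t)) (I N)"
proof -
  let ?b = "ILess (IVar v) (IVar ''n'')"
  let ?c = "Seq c (IAssign v (IAdd (IVar v) (INum 1)))"
  \<comment> \<open>The variant is the number of rounds left. The counter value is stored in the
    invariant, because \<open>runs_While\<close> passes on only the variant.\<close>
  define J where "J r s \<longleftrightarrow> (\<exists>k. a \<le> k \<and> k \<le> N \<and> r = N - k \<and> fst s v = k \<and> fst s ''n'' = N \<and> I k s)"
    for r :: nat and s :: state
  have body: "runs ?c s (t + 4) (\<lambda>s'. \<exists>r'<r. J r' s')" if J: "J r s" and b: "bval ?b s" for r s
  proof -
    from J b obtain k where k: "a \<le> k" "k < N" "r = N - k" "fst s v = k" "fst s ''n'' = N" "I k s"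
      by (auto simp: J_def)
    show ?thesis
    proof (rule runs_Seq[OF runs_frame[OF step[OF k(1,2,4-6)]]], clarify)
      fix s' m
      assume "I (Suc k) ((fst (s', m))(v := Suc k), snd (s', m))"
        and "\<forall>u. u \<notin> index_writes c \<longrightarrow> fst (s', m) u = fst s u"
      then have "J (N - Suc k) (s'(v := Suc k), m)" and "s' v = k"
        using k v by (auto simp: J_def)
      then show "runs (IAssign v (IAdd (IVar v) (INum 1))) (s', m) 4 (\<lambda>s'. \<exists>r'<r. J r' s')"
        using k by (intro runs_mono[OF runs_loop_free[where Q = "J (N - Suc k)"]])
          (simp_all, meson diff_less_mono2 lessI)
    qed
  qed
  have "runs (For v a c) s (2 + Suc (N - a) * (1 + bcost ?b + (t + 4)))
      (\<lambda>s'. (\<exists>r. J r s') \<and> \<not> bval ?b s')"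
    unfolding For_def
  proof (rule runs_Seq[where R = "J (N - a)"])
    show "runs (IAssign v (INum a)) s 2 (J (N - a))"
      using init n a v by (intro runs_mono[OF runs_loop_free]) (auto simp: J_def)
  qed (rule runs_While[OF body])
  moreover have "2 + Suc (N - a) * (1 + bcost ?b + (t + 4)) \<le> 2 + Suc N * (8 + t)"
    by (intro add_left_mono mult_le_mono) auto
  ultimately show ?thesis
    by (rule runs_mono) (auto simp: J_def le_antisym not_less)
qed

section \<open>Bottom-up merge sort\<close>

text \<open>Blocks are aligned at multiples of \<open>w\<close>: doubling \<open>w\<close> fuses
  neighbouring pairs, and for \<open>w \<ge> N\<close> the whole row is one decreasing
  block.\<close>

definition blocks_sorted :: "nat \<Rightarrow> nat \<Rightarrow> (nat \<Rightarrow> real) \<Rightarrow> bool" where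
  "blocks_sorted N w A \<longleftrightarrow>
     (\<forall>p c d. p * w \<le> c \<longrightarrow> c \<le> d \<longrightarrow> d < Suc p * w \<longrightarrow> d < N \<longrightarrow> A d \<le> A c)"

text \<open>
  Here \<open>A\<close> is the source and \<open>B\<close> the target, \<open>k\<close> the next cell of \<open>B\<close> to be written, and \<open>a\<close> and \<open>b\<close>
  are the heads of the runs ending before \<open>mid\<close> and \<open>hi\<close>; \<open>mid\<close> and \<open>hi\<close> may exceed \<open>N\<close> in the last block.
  That \<open>B\<close> rearranges \<open>A\<close> is expressed by equality of the sums of all functions \<open>f\<close>.
\<close>

definition merge_inv :: "nat \<Rightarrow> nat \<Rightarrow> (nat \<Rightarrow> real) \<Rightarrow> nat \<Rightarrow> nat \<Rightarrow> nat \<Rightarrow> nat \<Rightarrow> nat \<Rightarrow> (nat \<Rightarrow> real) \<Rightarrow> bool"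
  where
  "merge_inv N w A k a b mid hi B \<longleftrightarrow>
     (\<exists>q. mid = q * (2 * w) + w \<and> hi = q * (2 * w) + 2 * w \<and>
        q * (2 * w) \<le> a \<and> a \<le> mid \<and> mid \<le> b \<and> b \<le> hi \<and> (b \<le> N \<or> b = mid) \<and> k = a + (b - mid) \<and>
        (\<forall>c. q * (2 * w) \<le> c \<longrightarrow> c < k \<longrightarrow>
           (a < mid \<longrightarrow> a < N \<longrightarrow> A a \<le> B c) \<and> (b < hi \<longrightarrow> b < N \<longrightarrow> A b \<le> B c))) \<and>
     (\<forall>f. (\<Sum>c<k. f (B c)) = (\<Sum>c<a. f (A c)) + (\<Sum>c=mid..<b. (f (A c) :: real))) \<and>
     blocks_sorted k (2 * w) B"

text \<open>Two aligned blocks that share a position coincide, so the new position \<open>k\<close>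
  lies in block \<open>q\<close> only and \<open>y\<close> has to be compared with earlier entries
  of that block alone.\<close>

lemma blocks_sorted_snoc:
  assumes "blocks_sorted k w B" "q * w \<le> k" "k < Suc q * w"
    and "\<And>c. q * w \<le> c \<Longrightarrow> c < k \<Longrightarrow> y \<le> B c"
  shows "blocks_sorted (Suc k) w (B(k := y))"
  unfolding blocks_sorted_def
proof (intro allI impI)
  fix p c d assume h: "p * w \<le> c" "c \<le> d" "d < Suc p * w" "d < Suc k"
  show "(B(k := y)) d \<le> (B(k := y)) c"
  proof (cases "d = k")
    case True
    have "p * w < Suc q * w" "q * w < Suc p * w" using h assms(2,3) True by linarith+
    then have "p < Suc q" "q < Suc p" by (simp_all only: mult_less_cancel2)
    then have "p = q" by simp
    then show ?thesis using assms(4)[of c] h True by auto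
  next
    case False
    then show ?thesis using h assms(1) unfolding blocks_sorted_def by auto
  qed
qed

lemma merge_inv_init:
  "merge_inv N w A 0 0 w w (w + w) B"
  by (auto simp: merge_inv_def blocks_sorted_def intro!: exI[of _ 0])

text \<open>\<open>k\<close> counts the cells taken from both runs, so reaching \<open>hi\<close>
  forces \<open>a = mid\<close> and \<open>b = hi\<close>. The two sums then join to a prefix of
  \<open>A\<close>, and nothing has been written to block \<open>Suc q\<close> yet.\<close>

lemma merge_inv_next_block:
  assumes "merge_inv N w A k a b mid hi B" "\<not> k < hi" "k < N" "1 \<le> w"
  shows "merge_inv N w A k hi (hi + w) (hi + w) (hi + w + w) B"
proof -
  from assms obtain q where q: "mid = q * (2 * w) + w" "hi = q * (2 * w) + 2 * w"
    "a \<le> mid" "mid \<le> b" "b \<le> hi" "k = a + (b - mid)"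
    and s: "\<forall>f. (\<Sum>c<k. f (B c)) = (\<Sum>c<a. f (A c)) + (\<Sum>c=mid..<b. (f (A c) :: real))"
    and bs: "blocks_sorted k (2 * w) B"
    unfolding merge_inv_def by blast
  have ab: "a = mid" "b = hi" using q assms(2) by linarith+
  have "(\<Sum>c<k. f (B c)) = (\<Sum>c<hi. (f (A c) :: real))" for f
    using s sum.atLeastLessThan_concat[of 0 mid hi "\<lambda>c. f (A c)"] q ab
    by (simp add: atLeast0LessThan)
  moreover have "k = hi" using q ab by simp
  ultimately show ?thesis
    using q bs unfolding merge_inv_def by (intro conjI exI[of _ "Suc q"]) auto
qed

text \<open>The next left head is no larger than \<open>A a\<close> since the left run is block
  \<open>2 * q\<close> of width \<open>w\<close>; an available right head is no larger by the
  comparison just made.\<close>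

lemma merge_inv_left:
  assumes "merge_inv N w A k a b mid hi B" "k < hi" "k < N" "blocks_sorted N w A"
    and "a < mid" "\<not> (b < hi \<and> b < N \<and> A a < A b)"
  shows "merge_inv N w A (Suc k) (Suc a) b mid hi (B(k := A a))"
proof -
  from assms(1) obtain q where q: "mid = q * (2 * w) + w" "hi = q * (2 * w) + 2 * w"
    "q * (2 * w) \<le> a" "a \<le> mid" "mid \<le> b" "b \<le> hi" "b \<le> N \<or> b = mid" "k = a + (b - mid)"
    and front: "\<And>c. q * (2 * w) \<le> c \<Longrightarrow> c < k \<Longrightarrow> (a < mid \<longrightarrow> a < N \<longrightarrow> A a \<le> B c) \<and> (b < hi \<longrightarrow> b < N \<longrightarrow> A b \<le> B c)"
    and s: "\<forall>f. (\<Sum>c<k. f (B c)) = (\<Sum>c<a. f (A c)) + (\<Sum>c=mid..<b. (f (A c) :: real))"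
    and bs: "blocks_sorted k (2 * w) B"
    unfolding merge_inv_def by blast
  \<comment> \<open>The program does not test this. If \<open>b = mid\<close> then
    \<open>a = k\<close>; otherwise \<open>a < mid \<le> b \<le> N\<close>.\<close>
  have aN: "a < N" using q assms by linarith
  have next_le: "A (Suc a) \<le> A a" if "Suc a < mid" "Suc a < N"
    using assms(4)[unfolded blocks_sorted_def, rule_format, of "2 * q" a "Suc a"] q that by simp
  have sums: "(\<Sum>c<Suc k. f ((B(k := A a)) c)) = (\<Sum>c<Suc a. f (A c)) + (\<Sum>c=mid..<b. (f (A c) :: real))" for f
    using s by simp
  have sorted: "blocks_sorted (Suc k) (2 * w) (B(k := A a))"
    using q assms(2,5) front aN by (intro blocks_sorted_snoc[OF bs, of q]) auto
  have "\<forall>c. q * (2 * w) \<le> c \<longrightarrow> c < Suc k \<longrightarrow>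
     (Suc a < mid \<longrightarrow> Suc a < N \<longrightarrow> A (Suc a) \<le> (B(k := A a)) c) \<and>
     (b < hi \<longrightarrow> b < N \<longrightarrow> A b \<le> (B(k := A a)) c)"
    using front next_le assms(5,6) aN by (auto simp: less_Suc_eq intro: order_trans)
  then show ?thesis
    unfolding merge_inv_def using q assms(5) sums sorted
    by (intro conjI exI[of _ q]) auto
qed

lemma merge_inv_right:
  assumes "merge_inv N w A k a b mid hi B" "k < hi" "k < N" "blocks_sorted N w A"
    and "\<not> a < mid \<or> (b < hi \<and> b < N \<and> A a < A b)"
  shows "merge_inv N w A (Suc k) a (Suc b) mid hi (B(k := A b))"
proof -
  from assms(1) obtain q where q: "mid = q * (2 * w) + w" "hi = q * (2 * w) + 2 * w"
    "q * (2 * w) \<le> a" "a \<le> mid" "mid \<le> b" "b \<le> hi" "b \<le> N \<or> b = mid" "k = a + (b - mid)"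
    and front: "\<And>c. q * (2 * w) \<le> c \<Longrightarrow> c < k \<Longrightarrow> (a < mid \<longrightarrow> a < N \<longrightarrow> A a \<le> B c) \<and> (b < hi \<longrightarrow> b < N \<longrightarrow> A b \<le> B c)"
    and s: "\<forall>f. (\<Sum>c<k. f (B c)) = (\<Sum>c<a. f (A c)) + (\<Sum>c=mid..<b. (f (A c) :: real))"
    and bs: "blocks_sorted k (2 * w) B"
    unfolding merge_inv_def by blast
  \<comment> \<open>If the left run is used up then \<open>a = mid\<close> gives
    \<open>b = k\<close>, and the bounds on \<open>k\<close> apply; otherwise the comparison
    supplies them.\<close>
  have b: "b < hi" "b < N" "a < mid \<Longrightarrow> A a < A b" using q assms by linarith+
  have next_le: "A (Suc b) \<le> A b" if "Suc b < hi" "Suc b < N"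
    using assms(4)[unfolded blocks_sorted_def, rule_format, of "Suc (2 * q)" b "Suc b"] q that by simp
  have sums: "(\<Sum>c<Suc k. f ((B(k := A b)) c)) = (\<Sum>c<a. f (A c)) + (\<Sum>c=mid..<Suc b. (f (A c) :: real))" for f
    using s q by simp
  have sorted: "blocks_sorted (Suc k) (2 * w) (B(k := A b))"
    using q assms(2) front b by (intro blocks_sorted_snoc[OF bs, of q]) auto
  have "\<forall>c. q * (2 * w) \<le> c \<longrightarrow> c < Suc k \<longrightarrow>
     (a < mid \<longrightarrow> a < N \<longrightarrow> A a \<le> (B(k := A b)) c) \<and>
     (Suc b < hi \<longrightarrow> Suc b < N \<longrightarrow> A (Suc b) \<le> (B(k := A b)) c)"
    using front next_le b by (auto simp: less_Suc_eq intro: order_trans less_imp_le)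
  then show ?thesis
    unfolding merge_inv_def using q b sums sorted
    by (intro conjI exI[of _ q]) auto
qed

text \<open>The last block may be cut off by \<open>N\<close>. Either the right run was never
  touched and \<open>a = N\<close>, or \<open>b \<le> N\<close> together with
  \<open>N = a + (b - mid)\<close> and \<open>a \<le> mid\<close> forces \<open>b = N\<close> and
  \<open>a = mid\<close>.\<close>

lemma merge_inv_end:
  assumes "merge_inv N w A N a b mid hi B"
  shows "blocks_sorted N (2 * w) B" "\<forall>f. (\<Sum>c<N. f (B c)) = (\<Sum>c<N. (f (A c) :: real))"
proof -
  from assms obtain q where q:
    "a \<le> mid" "mid \<le> b" "b \<le> N \<or> b = mid" "N = a + (b - mid)"
    and s: "\<forall>f. (\<Sum>c<N. f (B c)) = (\<Sum>c<a. f (A c)) + (\<Sum>c=mid..<b. (f (A c) :: real))"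
    unfolding merge_inv_def by blast
  show "blocks_sorted N (2 * w) B" using assms by (simp add: merge_inv_def)
  show "\<forall>f. (\<Sum>c<N. f (B c)) = (\<Sum>c<N. (f (A c) :: real))"
  proof (cases "b = mid")
    case True
    then show ?thesis using s q by simp
  next
    case False
    then have "b = N" "a = mid" using q by linarith+
    moreover have "(\<Sum>c<mid. f (A c)) + (\<Sum>c=mid..<b. f (A c)) = (\<Sum>c<b. (f (A c) :: real))" for f
      using sum.atLeastLessThan_concat[of 0 mid b "\<lambda>c. f (A c)"] q by (simp add: atLeast0LessThan)
    ultimately show ?thesis using s by metis
  qed
qed

section \<open>Merge sort as a program\<close>

abbreviation cell :: "string \<Rightarrow> rexp" where
  "cell v \<equiv> RArr v (INum 0) (INum 0)"

abbreviation entry :: "string \<Rightarrow> string \<Rightarrow> rexp" where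
  "entry v k \<equiv> RArr v (INum 0) (IVar k)"

text \<open>Opening the next block is a branch inside the loop over output cells, so a pass is a
  single counting loop with constant time per cell, whatever the block width.\<close>

definition merge_body :: com where
  "merge_body = Seq
     (Cond (BNot (ILess (IVar ''k'') (IVar ''hi'')))
       (Seq (IAssign ''a'' (IVar ''hi''))
       (Seq (IAssign ''mid'' (IAdd (IVar ''a'') (IVar ''w'')))
       (Seq (IAssign ''b'' (IVar ''mid''))
            (IAssign ''hi'' (IAdd (IVar ''mid'') (IVar ''w''))))))
       Skip)
     (Cond (BAnd (ILess (IVar ''a'') (IVar ''mid''))
             (BNot (BAnd (ILess (IVar ''b'') (IVar ''hi''))
                   (BAnd (ILess (IVar ''b'') (IVar ''n'')) (RLess (entry ''Y'' ''a'') (entry ''Y'' ''b''))))))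
       (Seq (RAssign ''B'' (INum 0) (IVar ''k'') (entry ''Y'' ''a''))
            (IAssign ''a'' (IAdd (IVar ''a'') (INum 1))))
       (Seq (RAssign ''B'' (INum 0) (IVar ''k'') (entry ''Y'' ''b''))
            (IAssign ''b'' (IAdd (IVar ''b'') (INum 1)))))"

definition merge_pass :: com where
  "merge_pass =
     Seq (Seq (IAssign ''a'' (INum 0))
         (Seq (IAssign ''mid'' (IVar ''w''))
         (Seq (IAssign ''b'' (IVar ''w''))
              (IAssign ''hi'' (IAdd (IVar ''w'') (IVar ''w''))))))
       (For ''k'' 0 merge_body)"

lemma runs_merge_pass:
  assumes n: "fst s ''n'' = N" and w: "fst s ''w'' = w" "1 \<le> w"
    and A: "snd s ''Y'' 0 = A" "blocks_sorted N w A"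
  shows "runs merge_pass s (12 + (2 + Suc N * (8 + max_cost merge_body)))
     (\<lambda>s'. blocks_sorted N (2 * w) (snd s' ''B'' 0) \<and>
           (\<forall>f. (\<Sum>c<N. f (snd s' ''B'' 0 c)) = (\<Sum>c<N. (f (A c) :: real))))"
proof -
  define I where "I k s \<longleftrightarrow> fst s ''n'' = N \<and> fst s ''w'' = w \<and> snd s ''Y'' 0 = A \<and>
      merge_inv N w A k (fst s ''a'') (fst s ''b'') (fst s ''mid'') (fst s ''hi'') (snd s ''B'' 0)"
    for k and s :: state
  have "runs merge_pass s (12 + (2 + Suc N * (8 + max_cost merge_body))) (I N)"
    unfolding merge_pass_def
  proof (rule runs_Seq[where R = "\<lambda>s. fst s ''n'' = N \<and> I 0 s"])
    show "runs (Seq (IAssign ''a'' (INum 0))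
         (Seq (IAssign ''mid'' (IVar ''w''))
         (Seq (IAssign ''b'' (IVar ''w''))
              (IAssign ''hi'' (IAdd (IVar ''w'') (IVar ''w'')))))) s 12
         (\<lambda>s. fst s ''n'' = N \<and> I 0 s)"
      using n w A merge_inv_init[of N w A "snd s ''B'' 0"]
      by (intro runs_mono[OF runs_loop_free]) (auto simp: I_def)
  next
    fix s assume "fst s ''n'' = N \<and> I 0 s"
    then show "runs (For ''k'' 0 merge_body) s (2 + Suc N * (8 + max_cost merge_body)) (I N)"
    proof (intro runs_For)
      fix k and s :: state
      assume k: "k < N" "fst s ''k'' = k" and "I k s"
      then have inv: "merge_inv N w A k (fst s ''a'') (fst s ''b'') (fst s ''mid'') (fst s ''hi'') (snd s ''B'' 0)"
        and s: "fst s ''n'' = N" "fst s ''w'' = w" "snd s ''Y'' 0 = A"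
        by (auto simp: I_def)
      show "runs merge_body s (max_cost merge_body)
          (\<lambda>s'. I (Suc k) ((fst s')(''k'' := Suc k), snd s'))"
      proof (rule runs_loop_free)
        show "I (Suc k) ((fst (eff merge_body s))(''k'' := Suc k), snd (eff merge_body s))"
        proof (cases "k < fst s ''hi''")
          case True
          then show ?thesis
            using merge_inv_left[OF inv True k(1) A(2)] merge_inv_right[OF inv True k(1) A(2)] k s
            by (auto simp: I_def merge_body_def arr_upd_def)
        next
          case False
          note inv' = merge_inv_next_block[OF inv False k(1) w(2)]
          have hi: "k < fst s ''hi'' + w + w"
            using inv' w(2) unfolding merge_inv_def by auto
          show ?thesis
            using False merge_inv_left[OF inv' hi k(1) A(2)] merge_inv_right[OF inv' hi k(1) A(2)] k s
            by (auto simp: I_def merge_body_def arr_upd_def)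
        qed
      qed (simp add: merge_body_def)
    qed (auto simp: I_def merge_body_def)
  qed
  then show ?thesis
    by (rule runs_mono) (auto simp: I_def dest: merge_inv_end)
qed

definition copy_body :: com where
  "copy_body = RAssign ''Y'' (INum 0) (IVar ''k'') (entry ''B'' ''k'')"

lemma runs_copy:
  assumes n: "fst s ''n'' = N"
  shows "runs (For ''k'' 0 copy_body) s (2 + Suc N * (8 + max_cost copy_body))
     (\<lambda>s'. \<forall>c<N. snd s' ''Y'' 0 c = snd s ''B'' 0 c)"
proof -
  define I where "I k s' \<longleftrightarrow> snd s' ''B'' = snd s ''B'' \<and> (\<forall>c<k. snd s' ''Y'' 0 c = snd s ''B'' 0 c)"
    for k and s' :: state
  have "runs (For ''k'' 0 copy_body) s (2 + Suc N * (8 + max_cost copy_body)) (I N)"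
  proof (rule runs_For[OF n])
    show "runs copy_body s' (max_cost copy_body) (\<lambda>s'. I (Suc k) ((fst s')(''k'' := Suc k), snd s'))"
      if "fst s' ''k'' = k" "I k s'" for k s'
      using that by (intro runs_loop_free) (auto simp: copy_body_def I_def arr_upd_def less_Suc_eq)
  qed (auto simp: copy_body_def I_def)
  then show ?thesis by (rule runs_mono) (auto simp: I_def)
qed

definition sort_body :: com where
  "sort_body = Seq merge_pass (Seq (For ''k'' 0 copy_body) (IAssign ''w'' (IAdd (IVar ''w'') (IVar ''w''))))"

definition sort_row :: com where
  "sort_row = Seq (IAssign ''w'' (INum 1)) (While (ILess (IVar ''w'') (IVar ''n'')) sort_body)"

definition sort_body_time :: "nat \<Rightarrow> nat" where
  "sort_body_time N = 12 + (2 + Suc N * (8 + max_cost merge_body)) + (2 + Suc N * (8 + max_cost copy_body) + 4)"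

lemma writes_sort_body:
  "index_writes sort_body = {''a'', ''b'', ''mid'', ''hi'', ''k'', ''w''}"
  "array_writes sort_body = {''B'', ''Y''}"
  by (auto simp: sort_body_def merge_pass_def merge_body_def copy_body_def)

lemma runs_sort_body:
  assumes n: "fst s ''n'' = N" and w: "1 \<le> fst s ''w''" and A: "blocks_sorted N (fst s ''w'') (snd s ''Y'' 0)"
  shows "runs sort_body s (sort_body_time N)
     (\<lambda>s'. fst s' ''n'' = N \<and> fst s' ''w'' = 2 * fst s ''w'' \<and> blocks_sorted N (2 * fst s ''w'') (snd s' ''Y'' 0) \<and>
           (\<forall>f. (\<Sum>c<N. f (snd s' ''Y'' 0 c)) = (\<Sum>c<N. (f (snd s ''Y'' 0 c) :: real))))"
  unfolding sort_body_def sort_body_time_def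
proof (rule runs_Seq[OF runs_frame[OF runs_merge_pass[OF n refl w refl A]]])
  fix s1
  assume "(blocks_sorted N (2 * fst s ''w'') (snd s1 ''B'' 0) \<and>
       (\<forall>f. (\<Sum>c<N. f (snd s1 ''B'' 0 c)) = (\<Sum>c<N. (f (snd s ''Y'' 0 c) :: real)))) \<and>
     (\<forall>v. v \<notin> index_writes merge_pass \<longrightarrow> fst s1 v = fst s v) \<and>
     (\<forall>v. v \<notin> array_writes merge_pass \<longrightarrow> snd s1 v = snd s v)"
  then have B: "blocks_sorted N (2 * fst s ''w'') (snd s1 ''B'' 0)"
       "\<forall>f. (\<Sum>c<N. f (snd s1 ''B'' 0 c)) = (\<Sum>c<N. (f (snd s ''Y'' 0 c) :: real))"
    and s1: "fst s1 ''n'' = N" "fst s1 ''w'' = fst s ''w''"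
    using n by (auto simp: merge_pass_def merge_body_def)
  show "runs (Seq (For ''k'' 0 copy_body) (IAssign ''w'' (IAdd (IVar ''w'') (IVar ''w'')))) s1
      (2 + Suc N * (8 + max_cost copy_body) + 4)
      (\<lambda>s'. fst s' ''n'' = N \<and> fst s' ''w'' = 2 * fst s ''w'' \<and> blocks_sorted N (2 * fst s ''w'') (snd s' ''Y'' 0) \<and>
           (\<forall>f. (\<Sum>c<N. f (snd s' ''Y'' 0 c)) = (\<Sum>c<N. (f (snd s ''Y'' 0 c) :: real))))"
    using B s1
    by (intro runs_Seq[OF runs_frame[OF runs_copy[OF s1(1)]]] runs_mono[OF runs_loop_free])
       (auto simp: copy_body_def blocks_sorted_def)
qed

definition sort_time :: "nat \<Rightarrow> nat \<Rightarrow> nat" where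
  "sort_time N L = 2 + Suc L * (4 + sort_body_time N)"

text \<open>The variant \<open>r\<close> is a number of doublings that still suffices,
  \<open>N \<le> w * 2 ^ r\<close>. It starts at \<open>L\<close> since \<open>w\<close> starts at
  1, and at exit block 0 covers the row.\<close>

lemma runs_sort_row:
  assumes n: "fst s ''n'' = N" and L: "N \<le> 2 ^ L"
  shows "runs sort_row s (sort_time N L)
     (\<lambda>s'. (\<forall>c d. c \<le> d \<longrightarrow> d < N \<longrightarrow> snd s' ''Y'' 0 d \<le> snd s' ''Y'' 0 c) \<and>
           (\<forall>f. (\<Sum>c<N. f (snd s' ''Y'' 0 c)) = (\<Sum>c<N. (f (snd s ''Y'' 0 c) :: real))))"
proof -
  let ?b = "ILess (IVar ''w'') (IVar ''n'')"
  define I where "I r s' \<longleftrightarrow> fst s' ''n'' = N \<and> 1 \<le> fst s' ''w'' \<and> N \<le> fst s' ''w'' * 2 ^ r \<and>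
      blocks_sorted N (fst s' ''w'') (snd s' ''Y'' 0) \<and>
      (\<forall>f. (\<Sum>c<N. f (snd s' ''Y'' 0 c)) = (\<Sum>c<N. (f (snd s ''Y'' 0 c) :: real)))"
    for r :: nat and s' :: state
  have "runs sort_row s (2 + Suc L * (1 + bcost ?b + sort_body_time N)) (\<lambda>s'. (\<exists>r. I r s') \<and> \<not> bval ?b s')"
    unfolding sort_row_def
  proof (rule runs_Seq[where R = "I L"])
    have "blocks_sorted N 1 A" for A
      unfolding blocks_sorted_def by (metis Suc_eq_plus1 le_less_trans less_Suc_eq_le mult_1_right nle_le order_refl)
    then show "runs (IAssign ''w'' (INum 1)) s 2 (I L)"
      using n L by (intro runs_mono[OF runs_loop_free]) (simp_all add: I_def)
    show "runs (While ?b sort_body) s1 (Suc L * (1 + bcost ?b + sort_body_time N)) (\<lambda>s'. (\<exists>r. I r s') \<and> \<not> bval ?b s')"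
      if "I L s1" for s1
    proof (rule runs_While[of I, OF _ that])
      fix r s2 assume I: "I r s2" and b: "bval ?b s2"
      \<comment> \<open>As long as \<open>w < N\<close>, at least one doubling is missing, so
        \<open>r\<close> is positive.\<close>
      then obtain r' where r: "r = Suc r'" by (cases r) (auto simp: I_def)
      show "runs sort_body s2 (sort_body_time N) (\<lambda>s'. \<exists>r'<r. I r' s')"
        using I by (intro runs_mono[OF runs_sort_body[of s2 N]]) (auto simp: I_def r intro!: exI[of _ r'])
    qed
  qed
  then show ?thesis
  proof (rule runs_mono)
    fix s' assume "(\<exists>r. I r s') \<and> \<not> bval ?b s'"
    then have I: "blocks_sorted N (fst s' ''w'') (snd s' ''Y'' 0)" "N \<le> fst s' ''w''"
        "\<forall>f. (\<Sum>c<N. f (snd s' ''Y'' 0 c)) = (\<Sum>c<N. (f (snd s ''Y'' 0 c) :: real))"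
      by (auto simp: I_def)
    moreover have "snd s' ''Y'' 0 d \<le> snd s' ''Y'' 0 c" if "c \<le> d" "d < N" for c d
      using I(1)[unfolded blocks_sorted_def, rule_format, of 0 c d] I(2) that by simp
    ultimately show "(\<forall>c d. c \<le> d \<longrightarrow> d < N \<longrightarrow> snd s' ''Y'' 0 d \<le> snd s' ''Y'' 0 c) \<and>
        (\<forall>f. (\<Sum>c<N. f (snd s' ''Y'' 0 c)) = (\<Sum>c<N. (f (snd s ''Y'' 0 c) :: real)))"
      by blast
  qed (simp add: sort_time_def algebra_simps)
qed

section \<open>Evaluating the dual function\<close>

text \<open>The new entry is the smallest so far. Below the threshold it is truncated and changes
  nothing; above it, no entry is truncated by the new threshold, which therefore solves a linear
  equation.\<close>

lemma threshold_step:
  fixes A :: "nat \<Rightarrow> real"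
  assumes desc: "\<And>c. c \<le> k \<Longrightarrow> A k \<le> A c" and t: "(\<Sum>c<k. max 0 (A c - t)) = b"
  shows "(\<Sum>c<Suc k. max 0 (A c - (if t < A k then ((\<Sum>c<Suc k. A c) - b) / real (Suc k) else t))) = b"
proof (cases "t < A k")
  case True
  define t' where "t' = ((\<Sum>c<Suc k. A c) - b) / real (Suc k)"
  \<comment> \<open>all earlier entries exceed \<open>t\<close>, so \<open>t'\<close> is an average of \<open>A k\<close> and \<open>k\<close> copies of \<open>t\<close>\<close>
  have "max 0 (A c - t) = A c - t" if "c < k" for c
    using desc[of c] that True by auto
  then have "(\<Sum>c<k. A c) - real k * t = b"
    using t by (simp add: sum_subtractf)
  then have t': "real (Suc k) * t' = A k + real k * t"
    by (simp add: t'_def)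
  also have "\<dots> \<le> A k + real k * A k"
    using True by (intro add_left_mono mult_left_mono) auto
  also have "\<dots> = real (Suc k) * A k"
    by (simp add: algebra_simps)
  finally have "t' \<le> A k"
    by (rule mult_left_le_imp_le) simp
  then have "max 0 (A c - t') = A c - t'" if "c < Suc k" for c
    using desc[of c] that by auto
  then have "(\<Sum>c<Suc k. max 0 (A c - t')) = (\<Sum>c<Suc k. A c - t')"
    by (intro sum.cong) auto
  also have "\<dots> = (\<Sum>c<Suc k. A c) - real (Suc k) * t'"
    by (simp only: sum_subtractf sum_constant card_lessThan)
  also have "\<dots> = b"
    unfolding t'_def by simp
  finally show ?thesis
    using True unfolding t'_def by simp
qed (use t in auto)

text \<open>For a single entry the threshold is that entry minus the required sum, which is correct
  because the sum is nonnegative. The scan can therefore start at index 1.\<close>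

definition threshold_init :: com where
  "threshold_init = Seq (RAssign ''S'' (INum 0) (INum 0) (cell ''Y''))
     (Seq (RAssign ''m'' (INum 0) (INum 0) (RNum 1))
          (RAssign ''t'' (INum 0) (INum 0) (RSub (cell ''S'') (entry ''x'' ''i''))))"

text \<open>The cell \<open>''m''\<close> keeps the number of entries seen as a real, because the
  machine cannot convert an index into a real.\<close>

definition threshold_body :: com where
  "threshold_body = Seq (RAssign ''S'' (INum 0) (INum 0) (RAdd (cell ''S'') (entry ''Y'' ''k'')))
     (Seq (RAssign ''m'' (INum 0) (INum 0) (RAdd (cell ''m'') (RNum 1)))
          (Cond (RLess (cell ''t'') (entry ''Y'' ''k''))
             (RAssign ''t'' (INum 0) (INum 0) (RDiv (RSub (cell ''S'') (entry ''x'' ''i'')) (cell ''m'')))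
             Skip))"

definition threshold_row :: com where
  "threshold_row = Seq threshold_init (For ''k'' 1 threshold_body)"

definition threshold_time :: "nat \<Rightarrow> nat" where
  "threshold_time N = max_cost threshold_init + (2 + Suc N * (8 + max_cost threshold_body))"

lemma runs_threshold_row:
  assumes n: "fst s ''n'' = N" "1 \<le> N"
    and x: "0 \<le> snd s ''x'' 0 (fst s ''i'')"
    and desc: "\<And>c d. c \<le> d \<Longrightarrow> d < N \<Longrightarrow> snd s ''Y'' 0 d \<le> snd s ''Y'' 0 c"
  shows "runs threshold_row s (threshold_time N)
     (\<lambda>s'. (\<Sum>c<N. max 0 (snd s ''Y'' 0 c - snd s' ''t'' 0 0)) = snd s ''x'' 0 (fst s ''i''))"
proof -
  define A where "A = snd s ''Y'' 0"
  define b where "b = snd s ''x'' 0 (fst s ''i'')"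
  define I where "I k s' \<longleftrightarrow> fst s' ''n'' = N \<and> snd s' ''Y'' 0 = A \<and> snd s' ''x'' 0 (fst s' ''i'') = b \<and>
     snd s' ''S'' 0 0 = (\<Sum>c<k. A c) \<and> snd s' ''m'' 0 0 = real k \<and>
     (\<Sum>c<k. max 0 (A c - snd s' ''t'' 0 0)) = b" for k and s' :: state
  have "runs threshold_row s (threshold_time N) (I N)"
    unfolding threshold_row_def threshold_time_def
  proof (rule runs_Seq[where R = "I 1"])
    show "runs threshold_init s (max_cost threshold_init) (I 1)"
      using n x by (intro runs_loop_free)
        (auto simp: threshold_init_def I_def arr_upd_def A_def b_def)
  next
    fix s1 assume "I 1 s1"
    then show "runs (For ''k'' 1 threshold_body) s1 (2 + Suc N * (8 + max_cost threshold_body)) (I N)"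
    proof (intro runs_For)
      show "runs threshold_body s2 (max_cost threshold_body)
          (\<lambda>s'. I (Suc k) ((fst s')(''k'' := Suc k), snd s'))"
        if "k < N" "fst s2 ''k'' = k" "I k s2" for k s2
      proof (rule runs_loop_free)
        have t: "(\<Sum>c<k. max 0 (A c - snd s2 ''t'' 0 0)) = b"
          using that(3) by (simp add: I_def)
        have "A k \<le> A c" if "c \<le> k" for c
          using desc[of c k] \<open>k < N\<close> that by (simp add: A_def)
        from threshold_step[of k A, OF this t]
        show "I (Suc k) ((fst (eff threshold_body s2))(''k'' := Suc k), snd (eff threshold_body s2))"
          using that(2,3) by (auto simp: I_def threshold_body_def arr_upd_def add.commute[of _ 1])
      qed (simp add: threshold_body_def)
    qed (use n in \<open>auto simp: I_def threshold_body_def\<close>)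
  qed
  then show ?thesis
    by (rule runs_mono) (auto simp: I_def A_def b_def)
qed

section \<open>Loading a row and summing its contributions\<close>

definition load_body :: com where
  "load_body = RAssign ''Y'' (INum 0) (IVar ''k'')
     (RSub (RArr ''G'' (IVar ''i'') (IVar ''k'')) (RMul (cell ''lambda'') (RArr ''C'' (IVar ''i'') (IVar ''k''))))"

lemma runs_load:
  assumes n: "fst s ''n'' = N"
  shows "runs (For ''k'' 0 load_body) s (2 + Suc N * (8 + max_cost load_body))
     (\<lambda>s'. \<forall>c<N. snd s' ''Y'' 0 c =
        snd s ''G'' (fst s ''i'') c - snd s ''lambda'' 0 0 * snd s ''C'' (fst s ''i'') c)"
proof -
  define I where "I k s' \<longleftrightarrow> snd s' ''G'' = snd s ''G'' \<and> snd s' ''C'' = snd s ''C'' \<and>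
      snd s' ''lambda'' = snd s ''lambda'' \<and> fst s' ''i'' = fst s ''i'' \<and> (\<forall>c<k. snd s' ''Y'' 0 c =
        snd s ''G'' (fst s ''i'') c - snd s ''lambda'' 0 0 * snd s ''C'' (fst s ''i'') c)"
    for k and s' :: state
  have "runs (For ''k'' 0 load_body) s (2 + Suc N * (8 + max_cost load_body)) (I N)"
  proof (rule runs_For[OF n])
    show "runs load_body s' (max_cost load_body) (\<lambda>s'. I (Suc k) ((fst s')(''k'' := Suc k), snd s'))"
      if "fst s' ''k'' = k" "I k s'" for k s'
      using that by (intro runs_loop_free) (auto simp: load_body_def I_def arr_upd_def less_Suc_eq)
  qed (auto simp: load_body_def I_def)
  then show ?thesis by (rule runs_mono) (auto simp: I_def)
qed

text \<open>The entries are recomputed from \<open>G\<close> and \<open>C\<close>: sorting has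
  destroyed the column order of \<open>''Y''\<close> that the pairing with \<open>C\<close>
  needs.\<close>

definition accumulate_body :: com where
  "accumulate_body = Seq (RAssign ''z'' (INum 0) (INum 0)
     (RSub (RSub (RArr ''G'' (IVar ''i'') (IVar ''k''))
                 (RMul (cell ''lambda'') (RArr ''C'' (IVar ''i'') (IVar ''k''))))
           (cell ''t'')))
     (Seq (Cond (RLess (cell ''z'') (RNum 0)) (RAssign ''z'' (INum 0) (INum 0) (RNum 0)) Skip)
     (Seq (RAssign ''g'' (INum 0) (INum 0) (RAdd (cell ''g'')
            (RAdd (RMul (RDiv (RNum 1) (RNum 2))
                     (RMul (RSub (cell ''z'') (RArr ''G'' (IVar ''i'') (IVar ''k'')))
                           (RSub (cell ''z'') (RArr ''G'' (IVar ''i'') (IVar ''k'')))))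
                  (RMul (cell ''lambda'') (RMul (cell ''z'') (RArr ''C'' (IVar ''i'') (IVar ''k'')))))))
          (RAssign ''dg'' (INum 0) (INum 0) (RAdd (cell ''dg'')
            (RMul (cell ''z'') (RArr ''C'' (IVar ''i'') (IVar ''k'')))))))"

lemma runs_accumulate:
  fixes s :: state
  assumes n: "fst s ''n'' = N" and i: "fst s ''i'' = i"
    and inp: "snd s ''G'' = G" "snd s ''C'' = C" "snd s ''lambda'' 0 0 = l" "snd s ''t'' 0 0 = t"
  defines "z \<equiv> \<lambda>c. max 0 (G i c - l * C i c - t)"
  shows "runs (For ''k'' 0 accumulate_body) s (2 + Suc N * (8 + max_cost accumulate_body))
     (\<lambda>s'. snd s' ''g'' 0 0 = snd s ''g'' 0 0 + (\<Sum>c<N. 1/2 * (z c - G i c)\<^sup>2 + l * (z c * C i c)) \<and>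
           snd s' ''dg'' 0 0 = snd s ''dg'' 0 0 + (\<Sum>c<N. z c * C i c))"
proof -
  define I where "I k s' \<longleftrightarrow> snd s' ''G'' = G \<and> snd s' ''C'' = C \<and> fst s' ''i'' = i \<and>
      snd s' ''lambda'' 0 0 = l \<and> snd s' ''t'' 0 0 = t \<and>
      snd s' ''g'' 0 0 = snd s ''g'' 0 0 + (\<Sum>c<k. 1/2 * (z c - G i c)\<^sup>2 + l * (z c * C i c)) \<and>
      snd s' ''dg'' 0 0 = snd s ''dg'' 0 0 + (\<Sum>c<k. z c * C i c)"
    for k and s' :: state
  have "runs (For ''k'' 0 accumulate_body) s (2 + Suc N * (8 + max_cost accumulate_body)) (I N)"
  proof (rule runs_For[OF n])
    show "runs accumulate_body s' (max_cost accumulate_body) (\<lambda>s'. I (Suc k) ((fst s')(''k'' := Suc k), snd s'))"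
      if "fst s' ''k'' = k" "I k s'" for k s'
    proof (rule runs_loop_free)
      have "z k = (if G i k - l * C i k - t < 0 then 0 else G i k - l * C i k - t)"
        by (auto simp: z_def)
      then show "I (Suc k) ((fst (eff accumulate_body s'))(''k'' := Suc k), snd (eff accumulate_body s'))"
        using that by (auto simp: accumulate_body_def I_def arr_upd_def power2_eq_square)
    qed (simp add: accumulate_body_def)
  qed (use i inp in \<open>auto simp: accumulate_body_def I_def\<close>)
  then show ?thesis by (rule runs_mono) (auto simp: I_def)
qed

section \<open>Processing one row\<close>

definition row_program :: com where
  "row_program = Seq (For ''k'' 0 load_body) (Seq sort_row (Seq threshold_row (For ''k'' 0 accumulate_body)))"

definition row_time :: "nat \<Rightarrow> nat \<Rightarrow> nat" where
  "row_time N L = (2 + Suc N * (8 + max_cost load_body)) +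
     (sort_time N L + (threshold_time N + (2 + Suc N * (8 + max_cost accumulate_body))))"

lemma writes_row:
  "index_writes (For ''k'' 0 load_body) = {''k''}"
  "array_writes (For ''k'' 0 load_body) = {''Y''}"
  "index_writes sort_row = {''a'', ''b'', ''mid'', ''hi'', ''k'', ''w''}"
  "array_writes sort_row = {''B'', ''Y''}"
  "index_writes threshold_row = {''k''}"
  "array_writes threshold_row = {''S'', ''m'', ''t''}"
  "index_writes (For ''k'' 0 accumulate_body) = {''k''}"
  "array_writes (For ''k'' 0 accumulate_body) = {''z'', ''g'', ''dg''}"
  by (auto simp: load_body_def sort_row_def writes_sort_body threshold_row_def threshold_init_def
      threshold_body_def accumulate_body_def)

lemma writes_row_program:
  "index_writes row_program = {''a'', ''b'', ''mid'', ''hi'', ''k'', ''w''}"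
  "array_writes row_program = {''B'', ''Y'', ''S'', ''m'', ''t'', ''z'', ''g'', ''dg''}"
  by (auto simp: row_program_def writes_row simp del: writes_For)

lemma runs_row_program:
  fixes s :: state
  assumes n: "fst s ''n'' = N" "1 \<le> N" "N \<le> 2 ^ L" and i: "fst s ''i'' = i"
    and inp: "snd s ''G'' = G" "snd s ''C'' = C" "snd s ''lambda'' 0 0 = l" "snd s ''x'' 0 i = b" "0 \<le> b"
  shows "runs row_program s (row_time N L)
     (\<lambda>s'. \<exists>t. (\<Sum>c<N. max 0 (G i c - l * C i c - t)) = b \<and>
        snd s' ''g'' 0 0 = snd s ''g'' 0 0 + (\<Sum>c<N. 1/2 * (max 0 (G i c - l * C i c - t) - G i c)\<^sup>2
            + l * (max 0 (G i c - l * C i c - t) * C i c)) \<and>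
        snd s' ''dg'' 0 0 = snd s ''dg'' 0 0 + (\<Sum>c<N. max 0 (G i c - l * C i c - t) * C i c))"
    (is "runs _ _ _ ?Q")
proof -
  define Keep where "Keep s' \<longleftrightarrow> fst s' ''n'' = N \<and> fst s' ''i'' = i \<and>
     (\<forall>v \<in> {''G'', ''C'', ''lambda'', ''x'', ''g'', ''dg''}. snd s' v = snd s v)" for s' :: state
  show ?thesis
    unfolding row_program_def row_time_def
  proof (rule runs_Seq[OF runs_frame[OF runs_load[OF n(1)]]])
    fix s1
    assume 1: "(\<forall>c<N. snd s1 ''Y'' 0 c = snd s ''G'' (fst s ''i'') c - snd s ''lambda'' 0 0 * snd s ''C'' (fst s ''i'') c) \<and>
      (\<forall>v. v \<notin> index_writes (For ''k'' 0 load_body) \<longrightarrow> fst s1 v = fst s v) \<and>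
      (\<forall>v. v \<notin> array_writes (For ''k'' 0 load_body) \<longrightarrow> snd s1 v = snd s v)"
    then have Y1: "\<And>c. c < N \<Longrightarrow> snd s1 ''Y'' 0 c = G i c - l * C i c" and K1: "Keep s1"
      using n i inp by (auto simp: Keep_def writes_row simp del: writes_For)
    then have n1: "fst s1 ''n'' = N" by (simp add: Keep_def)
    show "runs (Seq sort_row (Seq threshold_row (For ''k'' 0 accumulate_body))) s1
        (sort_time N L + (threshold_time N + (2 + Suc N * (8 + max_cost accumulate_body)))) ?Q"
    proof (rule runs_Seq[OF runs_frame[OF runs_sort_row[OF n1 n(3)]]])
      fix s2
      assume 2: "((\<forall>c d. c \<le> d \<longrightarrow> d < N \<longrightarrow> snd s2 ''Y'' 0 d \<le> snd s2 ''Y'' 0 c) \<and>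
           (\<forall>f. (\<Sum>c<N. f (snd s2 ''Y'' 0 c)) = (\<Sum>c<N. (f (snd s1 ''Y'' 0 c) :: real)))) \<and>
        (\<forall>v. v \<notin> index_writes sort_row \<longrightarrow> fst s2 v = fst s1 v) \<and>
        (\<forall>v. v \<notin> array_writes sort_row \<longrightarrow> snd s2 v = snd s1 v)"
      then have K2: "Keep s2"
        using K1 by (auto simp: Keep_def writes_row)
      have desc: "\<And>c d. c \<le> d \<Longrightarrow> d < N \<Longrightarrow> snd s2 ''Y'' 0 d \<le> snd s2 ''Y'' 0 c"
        using 2 by blast
      have perm: "(\<Sum>c<N. f (snd s2 ''Y'' 0 c)) = (\<Sum>c<N. f (G i c - l * C i c))" for f :: "real \<Rightarrow> real"
        using 2 Y1 by simp
      have n2: "fst s2 ''n'' = N" and x2: "0 \<le> snd s2 ''x'' 0 (fst s2 ''i'')"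
        using K2 inp by (auto simp: Keep_def)
      show "runs (Seq threshold_row (For ''k'' 0 accumulate_body)) s2
          (threshold_time N + (2 + Suc N * (8 + max_cost accumulate_body))) ?Q"
      proof (rule runs_Seq[OF runs_frame[OF runs_threshold_row[OF n2 n(2) x2 desc]]])
        fix s3
        assume 3: "(\<Sum>c<N. max 0 (snd s2 ''Y'' 0 c - snd s3 ''t'' 0 0)) = snd s2 ''x'' 0 (fst s2 ''i'') \<and>
          (\<forall>v. v \<notin> index_writes threshold_row \<longrightarrow> fst s3 v = fst s2 v) \<and>
          (\<forall>v. v \<notin> array_writes threshold_row \<longrightarrow> snd s3 v = snd s2 v)"
        then have K3: "Keep s3"
          using K2 by (auto simp: Keep_def writes_row)
        \<comment> \<open>The threshold was fitted to the sorted row, but its equation is a sum over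
          all entries and is unaffected by rearrangement. \<open>perm\<close> holds for every
          \<open>f\<close>, so \<open>f\<close> may depend on the threshold found.\<close>
        have t: "(\<Sum>c<N. max 0 (G i c - l * C i c - snd s3 ''t'' 0 0)) = b"
          using 3 K2 inp perm[of "\<lambda>y. max 0 (y - snd s3 ''t'' 0 0)"] by (simp add: Keep_def)
        have s3: "fst s3 ''n'' = N" "fst s3 ''i'' = i" "snd s3 ''G'' = G" "snd s3 ''C'' = C"
            "snd s3 ''lambda'' 0 0 = l" "snd s3 ''g'' = snd s ''g''" "snd s3 ''dg'' = snd s ''dg''"
          using K3 inp by (auto simp: Keep_def)
        show "runs (For ''k'' 0 accumulate_body) s3 (2 + Suc N * (8 + max_cost accumulate_body)) ?Q"
          by (rule runs_mono[OF runs_accumulate[OF s3(1-5) refl] order_refl])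
             (use t s3(6,7) in auto)
      qed
    qed
  qed
qed

section \<open>The complete program\<close>

definition finish :: com where
  "finish = Seq (RAssign ''g'' (INum 0) (INum 0) (RSub (cell ''g'') (RMul (cell ''lambda'') (cell ''delta''))))
     (RAssign ''dg'' (INum 0) (INum 0) (RSub (cell ''dg'') (cell ''delta'')))"

definition dual_program :: com where
  "dual_program = Seq (For ''i'' 0 row_program) finish"

definition dual_time :: "nat \<Rightarrow> nat \<Rightarrow> nat" where
  "dual_time N L = 2 + Suc N * (8 + row_time N L) + max_cost finish"

lemma runs_dual_program:
  fixes s :: state
  assumes n: "fst s ''n'' = N" "1 \<le> N" "N \<le> 2 ^ L"
    and inp: "snd s ''G'' = G" "snd s ''C'' = C" "snd s ''lambda'' 0 0 = l" "snd s ''x'' 0 = x"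
      "snd s ''delta'' 0 0 = \<delta>" "\<And>i. i < N \<Longrightarrow> 0 \<le> x i" and zero: "snd s ''g'' 0 0 = 0" "snd s ''dg'' 0 0 = 0"
  shows "runs dual_program s (dual_time N L)
     (\<lambda>s'. \<exists>\<theta>. (\<forall>i<N. (\<Sum>c<N. max 0 (G i c - l * C i c - \<theta> i)) = x i) \<and>
        result s' ''g'' = (\<Sum>i<N. \<Sum>c<N. 1/2 * (max 0 (G i c - l * C i c - \<theta> i) - G i c)\<^sup>2
            + l * (max 0 (G i c - l * C i c - \<theta> i) * C i c)) - l * \<delta> \<and>
        result s' ''dg'' = (\<Sum>i<N. \<Sum>c<N. max 0 (G i c - l * C i c - \<theta> i) * C i c) - \<delta>)"
proof -
  define z where "z \<theta> i c = max 0 (G i c - l * C i c - \<theta> i)" for \<theta> :: "nat \<Rightarrow> real" and i c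
  define Keep where "Keep s' \<longleftrightarrow> fst s' ''n'' = N \<and>
     (\<forall>v \<in> {''G'', ''C'', ''lambda'', ''x'', ''delta''}. snd s' v = snd s v)" for s' :: state
  \<comment> \<open>The cell \<open>''t''\<close> is overwritten for each row, so the thresholds of
    finished rows survive only as an existential \<open>\<theta>\<close>, extended at
    \<open>k\<close> in each round.\<close>
  define I where "I k s' \<longleftrightarrow> Keep s' \<and> (\<exists>\<theta>. (\<forall>i<k. (\<Sum>c<N. z \<theta> i c) = x i) \<and>
        snd s' ''g'' 0 0 = (\<Sum>i<k. \<Sum>c<N. 1/2 * (z \<theta> i c - G i c)\<^sup>2 + l * (z \<theta> i c * C i c)) \<and>
        snd s' ''dg'' 0 0 = (\<Sum>i<k. \<Sum>c<N. z \<theta> i c * C i c))" for k and s' :: state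
  show ?thesis
    unfolding dual_program_def dual_time_def
  proof (rule runs_Seq[where R = "I N"])
    show "runs (For ''i'' 0 row_program) s (2 + Suc N * (8 + row_time N L)) (I N)"
    proof (rule runs_For[OF n(1)])
      show "runs row_program s' (row_time N L) (\<lambda>s'. I (Suc k) ((fst s')(''i'' := Suc k), snd s'))"
        if k: "k < N" "fst s' ''i'' = k" and I: "I k s'" for k s'
      proof -
        obtain \<theta> where K: "Keep s'" and \<theta>: "\<forall>i<k. (\<Sum>c<N. z \<theta> i c) = x i"
            "snd s' ''g'' 0 0 = (\<Sum>i<k. \<Sum>c<N. 1/2 * (z \<theta> i c - G i c)\<^sup>2 + l * (z \<theta> i c * C i c))"
            "snd s' ''dg'' 0 0 = (\<Sum>i<k. \<Sum>c<N. z \<theta> i c * C i c)"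
          using I unfolding I_def by blast
        have s': "fst s' ''n'' = N" "snd s' ''G'' = G" "snd s' ''C'' = C" "snd s' ''lambda'' 0 0 = l" "snd s' ''x'' 0 k = x k"
          using K inp by (auto simp: Keep_def)
        show ?thesis
        proof (rule runs_mono[OF runs_frame[OF runs_row_program[OF s'(1) n(2,3) k(2) s'(2-5) inp(6)[OF k(1)]]] order_refl], elim conjE exE)
          fix s2 t
          assume t: "(\<Sum>c<N. max 0 (G k c - l * C k c - t)) = x k"
              "snd s2 ''g'' 0 0 = snd s' ''g'' 0 0 + (\<Sum>c<N. 1/2 * (max 0 (G k c - l * C k c - t) - G k c)\<^sup>2
                 + l * (max 0 (G k c - l * C k c - t) * C k c))"
              "snd s2 ''dg'' 0 0 = snd s' ''dg'' 0 0 + (\<Sum>c<N. max 0 (G k c - l * C k c - t) * C k c)"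
            and frame: "\<forall>v. v \<notin> index_writes row_program \<longrightarrow> fst s2 v = fst s' v"
              "\<forall>v. v \<notin> array_writes row_program \<longrightarrow> snd s2 v = snd s' v"
          have zk: "z (\<theta>(k := t)) k c = max 0 (G k c - l * C k c - t)" for c
            by (simp add: z_def)
          have zi: "z (\<theta>(k := t)) i c = z \<theta> i c" if "i < k" for i c
            using that by (simp add: z_def)
          have "Keep ((fst s2)(''i'' := Suc k), snd s2)"
            using K frame by (auto simp: Keep_def writes_row_program)
          moreover have "\<forall>i<Suc k. (\<Sum>c<N. z (\<theta>(k := t)) i c) = x i"
            using \<theta>(1) t(1) by (auto simp: less_Suc_eq zk zi)
          moreover have "snd s2 ''g'' 0 0 = (\<Sum>i<Suc k. \<Sum>c<N. 1/2 * (z (\<theta>(k := t)) i c - G i c)\<^sup>2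
              + l * (z (\<theta>(k := t)) i c * C i c))"
            unfolding t(2) \<theta>(2) sum.lessThan_Suc zk by (simp add: zi)
          moreover have "snd s2 ''dg'' 0 0 = (\<Sum>i<Suc k. \<Sum>c<N. z (\<theta>(k := t)) i c * C i c)"
            unfolding t(3) \<theta>(3) sum.lessThan_Suc zk by (simp add: zi)
          ultimately show "I (Suc k) ((fst s2)(''i'' := Suc k), snd s2)"
            unfolding I_def by (intro conjI exI[of _ "\<theta>(k := t)"]) (simp_all only: snd_conv)
        qed
      qed
    qed (use n inp zero in \<open>auto simp: I_def Keep_def writes_row_program\<close>)
  next
    fix s1 assume "I N s1"
    then show "runs finish s1 (max_cost finish)
     (\<lambda>s'. \<exists>\<theta>. (\<forall>i<N. (\<Sum>c<N. max 0 (G i c - l * C i c - \<theta> i)) = x i) \<and>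
        result s' ''g'' = (\<Sum>i<N. \<Sum>c<N. 1/2 * (max 0 (G i c - l * C i c - \<theta> i) - G i c)\<^sup>2
            + l * (max 0 (G i c - l * C i c - \<theta> i) * C i c)) - l * \<delta> \<and>
        result s' ''dg'' = (\<Sum>i<N. \<Sum>c<N. max 0 (G i c - l * C i c - \<theta> i) * C i c) - \<delta>)"
      unfolding I_def Keep_def z_def using inp
      by (intro runs_loop_free) (auto simp: finish_def result_def arr_upd_def)
  qed
qed

section \<open>Asymptotic running time\<close>

lemma dual_time_bound:
  obtains K where "\<And>N L. dual_time N L \<le> K * (Suc N * Suc N * Suc L)"
proof -
  define T where "T N L = Suc N * Suc N * Suc L" for N L :: nat
  have T: "1 \<le> T N L" "Suc N \<le> T N L" "Suc N * Suc N \<le> T N L" for N L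
    unfolding T_def by (simp_all add: algebra_simps)
  define a where "a = 8 + max_cost load_body"
  define b where "b = 8 + max_cost accumulate_body"
  define c where "c = 8 + max_cost threshold_body"
  define d where "d = max_cost threshold_init"
  define e where "e = (8 + max_cost merge_body) + (8 + max_cost copy_body)"
  have s: "sort_body_time N \<le> (20 + e) * Suc N" for N
    by (simp add: sort_body_time_def e_def algebra_simps)
  have "sort_time N L \<le> (26 + e) * (Suc N * Suc L)" for N L
  proof -
    have "sort_time N L \<le> 2 + Suc L * (4 + (20 + e) * Suc N)"
      unfolding sort_time_def using s by (intro add_left_mono mult_left_mono) auto
    also have "\<dots> \<le> (26 + e) * (Suc N * Suc L)"
      by (simp add: algebra_simps)
    finally show ?thesis .
  qed
  moreover have "row_time N L = sort_time N L + ((6 + d) * 1 + (a + b + c) * Suc N)" for N L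
    by (simp add: row_time_def threshold_time_def a_def b_def c_def d_def algebra_simps)
  moreover have "(6 + d) * 1 + (a + b + c) * Suc N \<le> (6 + a + b + c + d) * Suc N" for N
    by (simp add: algebra_simps)
  ultimately have r: "row_time N L \<le> (26 + e) * (Suc N * Suc L) + (6 + a + b + c + d) * Suc N" for N L
    by (metis add_mono)
  \<comment> \<open>The sum of all coefficients: the factors of \<open>T N L\<close> are at least 1,
    so it dominates every lower-order term.\<close>
  let ?K = "2 + 8 + 26 + e + 6 + a + b + c + d + max_cost finish"
  have "dual_time N L \<le> ?K * T N L" for N L
  proof -
    have "dual_time N L \<le> 2 + Suc N * (8 + ((26 + e) * (Suc N * Suc L) + (6 + a + b + c + d) * Suc N)) + max_cost finish"
      unfolding dual_time_def using r by (intro add_mono mult_left_mono order_refl) auto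
    also have "\<dots> = 2 * 1 + 8 * Suc N + (26 + e) * T N L + (6 + a + b + c + d) * (Suc N * Suc N) + max_cost finish * 1"
      by (simp only: T_def algebra_simps)
    also have "\<dots> \<le> 2 * T N L + 8 * T N L + (26 + e) * T N L + (6 + a + b + c + d) * T N L + max_cost finish * T N L"
      using T by (intro add_mono mult_left_mono) auto
    also have "\<dots> = ?K * T N L"
      by (simp only: distrib_right)
    finally show ?thesis .
  qed
  then show ?thesis using that unfolding T_def by blast
qed

definition ceiling_log2 :: "nat \<Rightarrow> nat" where
  "ceiling_log2 n = nat \<lceil>log 2 (real n)\<rceil>"

lemma le_power_ceiling_log2: "n \<le> 2 ^ ceiling_log2 n"
proof (cases "n = 0")
  case False
  then have "real n = 2 powr (log 2 (real n))" by simp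
  also have "\<dots> \<le> 2 powr (real (ceiling_log2 n))"
    unfolding ceiling_log2_def by (intro powr_mono) linarith+
  also have "\<dots> = real (2 ^ ceiling_log2 n)" by (simp add: powr_realpow)
  finally show ?thesis by (simp only: of_nat_le_iff)
qed simp

lemma time_bigo:
  assumes "\<And>n. T n \<le> K * (Suc n * Suc n * Suc (ceiling_log2 n))"
  shows "(\<lambda>n. real (T n)) \<in> O(\<lambda>n. (real n)\<^sup>2 * ln (real n))"
\<comment> \<open>For \<open>n \<ge> 2\<close>, each \<open>Suc n\<close> is at most
  \<open>2 * n\<close> and \<open>Suc (ceiling_log2 n)\<close> is at most
  \<open>3 * log 2 n\<close>; this gives 2 * 2 * 3 = 12, and \<open>ln 2\<close> comes from the
  change of base.\<close>
proof (rule bigoI[where c = "12 * real K / ln 2"])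
  have "norm (real (T n)) \<le> 12 * real K / ln 2 * norm ((real n)\<^sup>2 * ln (real n))" if n: "2 \<le> n" for n
  proof -
    have l: "0 < ln (2::real)" "ln 2 \<le> ln (real n)" using n by auto
    then have log: "1 \<le> log 2 (real n)" by (simp add: log_def)
    then have "real (ceiling_log2 n) \<le> log 2 (real n) + 1"
      unfolding ceiling_log2_def by linarith
    then have "real (Suc (ceiling_log2 n)) \<le> 3 * log 2 (real n)"
      using log by simp
    then have L: "real (Suc (ceiling_log2 n)) \<le> 3 * (ln (real n) / ln 2)"
      by (simp only: log_def)
    have N: "real (Suc n) \<le> 2 * real n" using n by simp
    have "real (T n) \<le> real K * (real (Suc n) * real (Suc n) * real (Suc (ceiling_log2 n)))"
      using assms[of n] by (metis of_nat_le_iff of_nat_mult)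
    also have "\<dots> \<le> real K * ((2 * real n) * (2 * real n) * (3 * (ln (real n) / ln 2)))"
      using N L by (intro mult_left_mono mult_mono) auto
    also have "\<dots> = 12 * real K / ln 2 * ((real n)\<^sup>2 * ln (real n))"
      by (simp add: power2_eq_square)
    also have "(real n)\<^sup>2 * ln (real n) = norm ((real n)\<^sup>2 * ln (real n))"
      using order_trans[OF less_imp_le[OF l(1)] l(2)] by (simp add: abs_mult)
    finally show ?thesis by simp
  qed
  then show "\<forall>\<^sub>F n in at_top. norm (real (T n)) \<le> 12 * real K / ln 2 * norm ((real n)\<^sup>2 * ln (real n))"
    by (intro eventually_at_top_linorderI[of 2]) auto
qed

text \<open>The thresholds found by the program satisfy the premise of
  \<open>strong_min_shrink\<close>. The matrix they define is never stored, but it is the minimiser,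
  and the accumulated sums are its Lagrangian and its slack.\<close>

lemma (in quadratic_program) runs_dual_program_input:
  "runs dual_program (input_state n x G C \<delta> l) (dual_time n (ceiling_log2 n))
     (\<lambda>s. result s ''g'' = dual_obj n x G C \<delta> l \<and>
          (dual_obj n x G C \<delta> has_real_derivative result s ''dg'') (at l))"
proof (rule runs_mono[OF runs_dual_program[OF _ n_pos le_power_ceiling_log2 refl refl refl refl refl] order_refl],
    goal_cases)
  case (5 s)
  let ?G = "\<lambda>i c. if i < n \<and> c < n then G $$ (i, c) else 0"
  let ?C = "\<lambda>i c. if i < n \<and> c < n then C $$ (i, c) else 0"
  from 5 obtain \<theta> where \<theta>: "\<forall>i<n. (\<Sum>c<n. max 0 (?G i c - l * ?C i c - \<theta> i)) = x $ i"
    and g: "result s ''g'' = (\<Sum>i<n. \<Sum>c<n. 1/2 * (max 0 (?G i c - l * ?C i c - \<theta> i) - ?G i c)\<^sup>2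
            + l * (max 0 (?G i c - l * ?C i c - \<theta> i) * ?C i c)) - l * \<delta>"
    and dg: "result s ''dg'' = (\<Sum>i<n. \<Sum>c<n. max 0 (?G i c - l * ?C i c - \<theta> i) * ?C i c) - \<delta>"
    by (auto simp: input_state_def input_arrays_def)
  let ?P = "shrink n G C l \<theta>"
  have Pc: "?P \<in> carrier_mat n n" by (simp add: shrink_def)
  have P: "strong_min l ?P"
    using \<theta> by (intro strong_min_shrink) simp
  have "result s ''g'' = dual_obj n x G C \<delta> l"
    unfolding dual_obj_strong_min[OF P] lagr_sum[OF Pc] g by (simp add: shrink_def)
  moreover have "result s ''dg'' = frob_inner ?P C - \<delta>"
    unfolding frob_inner_carrier[OF Pc] dg by (simp add: shrink_def)
  ultimately show ?case
    using dual_obj_deriv[OF P] by simp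
qed (use x_nonneg in \<open>auto simp: input_state_def input_ivars_def input_arrays_def\<close>)

theorem proposition1:
  shows
    "(\<forall>n x G C \<epsilon> \<delta>. qp_data n x G C \<epsilon> \<delta> \<longrightarrow>
        (\<forall>l. (\<exists>P. is_arg_min (\<lambda>P. 1/2 * (frob_norm (P - G))\<^sup>2 + l * (frob_inner P C - \<delta>))
                   (\<lambda>P. P \<in> couplings n x) P \<and>
                 dual_obj n x G C \<delta> l
                   = 1/2 * (frob_norm (P - G))\<^sup>2 + l * (frob_inner P C - \<delta>))) \<and>
        (\<forall>l. lagrange_dual_function (qp n x G C \<delta>) l = ereal (dual_obj n x G C \<delta> l)) \<and>
        (\<exists>l0\<ge>0. (\<forall>l\<ge>0. dual_obj n x G C \<delta> l \<le> dual_obj n x G C \<delta> l0) \<and>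
                 lagrange_dual_value (qp n x G C \<delta>) = ereal (dual_obj n x G C \<delta> l0)) \<and>
        (\<forall>l. \<exists>!P. is_arg_min (\<lambda>P. (frob_norm (P - G + l \<cdot>\<^sub>m C))\<^sup>2)
                    (\<lambda>P. P \<in> couplings n x) P) \<and>
        (\<forall>l P. is_arg_min (\<lambda>P. (frob_norm (P - G + l \<cdot>\<^sub>m C))\<^sup>2) (\<lambda>P. P \<in> couplings n x) P \<longrightarrow>
               (dual_obj n x G C \<delta> has_real_derivative (frob_inner P C - \<delta>)) (at l)))
     \<and>
     (\<exists>prog T. (\<lambda>n. real (T n)) \<in> O(\<lambda>n. (real n)\<^sup>2 * ln (real n)) \<and>
        (\<forall>n x G C \<epsilon> \<delta> l. qp_data n x G C \<epsilon> \<delta> \<longrightarrow>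
          (\<exists>t s. exec prog (input_state n x G C \<delta> l) t s \<and> t \<le> T n \<and>
                 result s ''g'' = dual_obj n x G C \<delta> l \<and>
                 (dual_obj n x G C \<delta> has_real_derivative result s ''dg'') (at l))))"
proof (intro conjI allI impI exI[of _ dual_program] exI[of _ "\<lambda>n. dual_time n (ceiling_log2 n)"])
  fix n x G C \<epsilon> \<delta> l
  assume "qp_data n x G C \<epsilon> \<delta>"
  then interpret quadratic_program n x G C \<epsilon> \<delta> by unfold_locales
  obtain P where P: "strong_min l P" using strong_min_exists by blast
  show "\<exists>P. is_arg_min (\<lambda>P. 1/2 * (frob_norm (P - G))\<^sup>2 + l * (frob_inner P C - \<delta>))
                   (\<lambda>P. P \<in> couplings n x) P \<and>
                 dual_obj n x G C \<delta> l
                   = 1/2 * (frob_norm (P - G))\<^sup>2 + l * (frob_inner P C - \<delta>)"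
    using strong_min_is_arg_min[OF P] dual_obj_strong_min[OF P] by blast
  show "lagrange_dual_function (qp n x G C \<delta>) l = ereal (dual_obj n x G C \<delta> l)"
    by (rule lagrange_dual_function_qp)
  \<comment> \<open>Both equivalences turn minimisers of the norm into strong minimisers, and
    quadratic growth makes any two of these equal.\<close>
  show "\<exists>!P. is_arg_min (\<lambda>P. (frob_norm (P - G + l \<cdot>\<^sub>m C))\<^sup>2) (\<lambda>P. P \<in> couplings n x) P"
    unfolding is_arg_min_norm_iff is_arg_min_iff_strong_min
    using P strong_min_eqI[OF P] strong_min_le[OF _ P[unfolded strong_min_def, THEN conjunct1]]
    by (intro ex1I[of _ P]) (auto simp: strong_min_def)
  show "(dual_obj n x G C \<delta> has_real_derivative (frob_inner P C - \<delta>)) (at l)"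
    if "is_arg_min (\<lambda>P. (frob_norm (P - G + l \<cdot>\<^sub>m C))\<^sup>2) (\<lambda>P. P \<in> couplings n x) P" for P
    using that unfolding is_arg_min_norm_iff is_arg_min_iff_strong_min by (rule dual_obj_deriv)
  show "\<exists>t s. exec dual_program (input_state n x G C \<delta> l) t s \<and> t \<le> dual_time n (ceiling_log2 n) \<and>
                 result s ''g'' = dual_obj n x G C \<delta> l \<and>
                 (dual_obj n x G C \<delta> has_real_derivative result s ''dg'') (at l)"
    using runs_dual_program_input unfolding runs_def .
next
  fix n x G C \<epsilon> \<delta>
  assume "qp_data n x G C \<epsilon> \<delta>"
  then interpret quadratic_program n x G C \<epsilon> \<delta> by unfold_locales
  show "\<exists>l0\<ge>0. (\<forall>l\<ge>0. dual_obj n x G C \<delta> l \<le> dual_obj n x G C \<delta> l0) \<and>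
                 lagrange_dual_value (qp n x G C \<delta>) = ereal (dual_obj n x G C \<delta> l0)"
    using dual_obj_attains_max lagrange_dual_value_qp by blast
next
  obtain K where "\<And>N L. dual_time N L \<le> K * (Suc N * Suc N * Suc L)"
    using dual_time_bound by blast
  then show "(\<lambda>n. real (dual_time n (ceiling_log2 n))) \<in> O(\<lambda>n. (real n)\<^sup>2 * ln (real n))"
    by (intro time_bigo)
qed

end
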